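(* Let $(\mathcal{A},\varphi)$ be an algebraic probability space and let $b=b^*\in\mathcal{A}$ be a real random variable with $\varphi(b)=0$ and $\varphi(b^2)=1$. For $1\le n\le N$ set $$b^{(N,n)}=\sum_{1\le i_1<\dots<i_n\le N} b(i_1)\cdots b(i_n)\in\mathcal{A}^{\otimes N}.$$ Then for every $n=1,2,\dots$, $$\frac{b^{(N,n)}}{N^{n/2}}\longrightarrow\frac{1}{n!}\tilde H_n(g)\quad\text{in moments as } N\to\infty,$$ where $g$ is a random variable obeying the standard normal law $N(0,1)$ and $\tilde H_n$ is the monic Hermite polynomial of degree $n$. That is, for every $m=1,2,\dots$, $$\lim_{N\to\infty}\varphi^{\otimes N}\left(\left(\frac{b^{(N,n)}}{N^{n/2}}\right)^m\right)=\mathbf{E}\left[\left(\frac{1}{n!}\tilde H_n(g)\right)^m\right].$$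
   Context: An algebraic probability space is a pair $(\mathcal{A},\varphi)$ where $\mathcal{A}$ is a unital $*$-algebra over $\mathbb{C}$ (no topology is assumed) and $\varphi:\mathcal{A}\to\mathbb{C}$ is a state, i.e. a $\mathbb{C}$-linear function with $\varphi(1)=1$ and $\varphi(a^*a)\ge 0$ for all $a\in\mathcal{A}$. An element $a\in\mathcal{A}$ is called real if $a^*=a$. $\mathcal{A}^{\otimes N}$ is the $N$-fold algebraic tensor power, with the product state $\varphi^{\otimes N}$ determined by $\varphi^{\otimes N}(a_1\otimes\cdots\otimes a_N)=\varphi(a_1)\cdots\varphi(a_N)$. For $i\in\{1,\dots,N\}$, $b(i)=1\otimes\cdots\otimes 1\otimes b\otimes 1\otimes\cdots\otimes 1\in\mathcal{A}^{\otimes N}$ with $b$ at the $i$-th position. The monic Hermite polynomials are defined by $\tilde H_0(x)=1$, $\tilde H_1(x)=x$, and $x\tilde H_n(x)=\tilde H_{n+1}(x)+n\tilde H_{n-1}(x)$ for $n\ge1$. *)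

theory Defs
  imports
    "HOL-Library.Poly_Mapping"
    "HOL-Computational_Algebra.Polynomial"
    "HOL-Probability.Probability"
    "HOL-Algebra.Module"
begin

record 'a star_algebra = "(complex, 'a) module" +
  star :: "'a \<Rightarrow> 'a"

locale unital_star_algebra = ring A for A :: "('a, 'm) star_algebra_scheme" (structure) +
  assumes scale_closed [simp, intro]: "a \<in> carrier A \<Longrightarrow> c \<odot> a \<in> carrier A"
    and scale_add_left: "a \<in> carrier A \<Longrightarrow> (c + d) \<odot> a = c \<odot> a \<oplus> d \<odot> a"
    and scale_add_right: "a \<in> carrier A \<Longrightarrow> b \<in> carrier A \<Longrightarrow> c \<odot> (a \<oplus> b) = c \<odot> a \<oplus> c \<odot> b"
    and scale_scale: "a \<in> carrier A \<Longrightarrow> c \<odot> (d \<odot> a) = (c * d) \<odot> a"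
    and scale_one: "a \<in> carrier A \<Longrightarrow> 1 \<odot> a = a"
    and mult_scale_left: "a \<in> carrier A \<Longrightarrow> b \<in> carrier A \<Longrightarrow> (c \<odot> a) \<otimes> b = c \<odot> (a \<otimes> b)"
    and mult_scale_right: "a \<in> carrier A \<Longrightarrow> b \<in> carrier A \<Longrightarrow> a \<otimes> (c \<odot> b) = c \<odot> (a \<otimes> b)"
    and star_closed [simp, intro]: "a \<in> carrier A \<Longrightarrow> star A a \<in> carrier A"
    and star_star: "a \<in> carrier A \<Longrightarrow> star A (star A a) = a"
    and star_add: "a \<in> carrier A \<Longrightarrow> b \<in> carrier A \<Longrightarrow> star A (a \<oplus> b) = star A a \<oplus> star A b"
    and star_scale: "a \<in> carrier A \<Longrightarrow> star A (c \<odot> a) = cnj c \<odot> star A a"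
    and star_mult: "a \<in> carrier A \<Longrightarrow> b \<in> carrier A \<Longrightarrow> star A (a \<otimes> b) = star A b \<otimes> star A a"

locale algebraic_probability_space = unital_star_algebra A
  for A :: "('a, 'm) star_algebra_scheme" (structure) +
  fixes \<phi> :: "'a \<Rightarrow> complex"
  assumes state_add: "a \<in> carrier A \<Longrightarrow> b \<in> carrier A \<Longrightarrow> \<phi> (a \<oplus> b) = \<phi> a + \<phi> b"
    and state_scale: "a \<in> carrier A \<Longrightarrow> \<phi> (c \<odot> a) = c * \<phi> a"
    and state_one: "\<phi> \<one> = 1"
    and state_nonneg: "a \<in> carrier A \<Longrightarrow> \<phi> (star A a \<otimes> a) \<in> \<real>\<^sub>\<ge>\<^sub>0"

text \<open>
  The algebraic tensor power is the free complex vector space on the \<open>N\<close>-tuples of elements of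
  \<open>A\<close>, modulo the span of the multilinearity relations; the product and the star are induced by
  the componentwise operations on tuples.  Tuples are extensional functions on \<open>{1..N}\<close>.
\<close>

definition tuples :: "('a, 'm) star_algebra_scheme \<Rightarrow> nat \<Rightarrow> (nat \<Rightarrow> 'a) set" where
  "tuples A N = {1..N} \<rightarrow>\<^sub>E carrier A"

definition formal_tensors ::
    "('a, 'm) star_algebra_scheme \<Rightarrow> nat \<Rightarrow> ((nat \<Rightarrow> 'a) \<Rightarrow>\<^sub>0 complex) set" where
  "formal_tensors A N = {f. Poly_Mapping.keys f \<subseteq> tuples A N}"

definition formal_scale :: "complex \<Rightarrow> ('k \<Rightarrow>\<^sub>0 complex) \<Rightarrow> 'k \<Rightarrow>\<^sub>0 complex" where
  "formal_scale c f = Poly_Mapping.map ((*) c) f"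

definition formal_mult :: "('a, 'm) star_algebra_scheme \<Rightarrow> nat \<Rightarrow>
    ((nat \<Rightarrow> 'a) \<Rightarrow>\<^sub>0 complex) \<Rightarrow> ((nat \<Rightarrow> 'a) \<Rightarrow>\<^sub>0 complex) \<Rightarrow> (nat \<Rightarrow> 'a) \<Rightarrow>\<^sub>0 complex" where
  "formal_mult A N f g = (\<Sum>x\<in>Poly_Mapping.keys f. \<Sum>y\<in>Poly_Mapping.keys g.
     Poly_Mapping.single (\<lambda>i\<in>{1..N}. x i \<otimes>\<^bsub>A\<^esub> y i)
       (Poly_Mapping.lookup f x * Poly_Mapping.lookup g y))"

definition formal_star :: "('a, 'm) star_algebra_scheme \<Rightarrow> nat \<Rightarrow>
    ((nat \<Rightarrow> 'a) \<Rightarrow>\<^sub>0 complex) \<Rightarrow> (nat \<Rightarrow> 'a) \<Rightarrow>\<^sub>0 complex" where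
  "formal_star A N f = (\<Sum>x\<in>Poly_Mapping.keys f.
     Poly_Mapping.single (\<lambda>i\<in>{1..N}. star A (x i)) (cnj (Poly_Mapping.lookup f x)))"

inductive_set multilinear_relations ::
    "('a, 'm) star_algebra_scheme \<Rightarrow> nat \<Rightarrow> ((nat \<Rightarrow> 'a) \<Rightarrow>\<^sub>0 complex) set"
  for A N where
  additive: "x \<in> tuples A N \<Longrightarrow> i \<in> {1..N} \<Longrightarrow> a \<in> carrier A \<Longrightarrow> b \<in> carrier A \<Longrightarrow>
    Poly_Mapping.single (x(i := a \<oplus>\<^bsub>A\<^esub> b)) 1
      - Poly_Mapping.single (x(i := a)) 1 - Poly_Mapping.single (x(i := b)) 1
      \<in> multilinear_relations A N"
| homogeneous: "x \<in> tuples A N \<Longrightarrow> i \<in> {1..N} \<Longrightarrow> a \<in> carrier A \<Longrightarrow>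
    Poly_Mapping.single (x(i := c \<odot>\<^bsub>A\<^esub> a)) 1 - Poly_Mapping.single (x(i := a)) c
      \<in> multilinear_relations A N"
| zero: "0 \<in> multilinear_relations A N"
| add: "f \<in> multilinear_relations A N \<Longrightarrow> g \<in> multilinear_relations A N \<Longrightarrow>
    f + g \<in> multilinear_relations A N"
| scale: "f \<in> multilinear_relations A N \<Longrightarrow> formal_scale c f \<in> multilinear_relations A N"

definition tensor_eq :: "('a, 'm) star_algebra_scheme \<Rightarrow> nat \<Rightarrow>
    (((nat \<Rightarrow> 'a) \<Rightarrow>\<^sub>0 complex) \<times> ((nat \<Rightarrow> 'a) \<Rightarrow>\<^sub>0 complex)) set" where
  "tensor_eq A N = {(f, g). f \<in> formal_tensors A N \<and> g \<in> formal_tensors A N \<and>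
     f - g \<in> multilinear_relations A N}"

definition tensor_class :: "('a, 'm) star_algebra_scheme \<Rightarrow> nat \<Rightarrow>
    ((nat \<Rightarrow> 'a) \<Rightarrow>\<^sub>0 complex) \<Rightarrow> ((nat \<Rightarrow> 'a) \<Rightarrow>\<^sub>0 complex) set" where
  "tensor_class A N f = tensor_eq A N `` {f}"

definition pure_tensor :: "('a, 'm) star_algebra_scheme \<Rightarrow> nat \<Rightarrow> (nat \<Rightarrow> 'a) \<Rightarrow>
    ((nat \<Rightarrow> 'a) \<Rightarrow>\<^sub>0 complex) set" where
  "pure_tensor A N x = tensor_class A N (Poly_Mapping.single (restrict x {1..N}) 1)"

definition tensor_power :: "('a, 'm) star_algebra_scheme \<Rightarrow> nat \<Rightarrow>
    ((nat \<Rightarrow> 'a) \<Rightarrow>\<^sub>0 complex) set star_algebra" where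
  "tensor_power A N = \<lparr>
     carrier = formal_tensors A N // tensor_eq A N,
     mult = (\<lambda>X Y. \<Union>f\<in>X. \<Union>g\<in>Y. tensor_class A N (formal_mult A N f g)),
     one = pure_tensor A N (\<lambda>_. \<one>\<^bsub>A\<^esub>),
     zero = tensor_class A N 0,
     add = (\<lambda>X Y. \<Union>f\<in>X. \<Union>g\<in>Y. tensor_class A N (f + g)),
     smult = (\<lambda>c X. \<Union>f\<in>X. tensor_class A N (formal_scale c f)),
     star = (\<lambda>X. \<Union>f\<in>X. tensor_class A N (formal_star A N f))\<rparr>"

definition formal_state :: "('a \<Rightarrow> complex) \<Rightarrow> nat \<Rightarrow> ((nat \<Rightarrow> 'a) \<Rightarrow>\<^sub>0 complex) \<Rightarrow> complex" where
  "formal_state \<phi> N f = (\<Sum>x\<in>Poly_Mapping.keys f. Poly_Mapping.lookup f x * (\<Prod>i\<in>{1..N}. \<phi> (x i)))"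

text \<open>
  \<open>formal_state \<phi> N\<close> is constant on each class, hence \<open>the_elem\<close> (see \<open>product_state_class\<close> below).
\<close>

definition product_state ::
    "('a \<Rightarrow> complex) \<Rightarrow> nat \<Rightarrow> ((nat \<Rightarrow> 'a) \<Rightarrow>\<^sub>0 complex) set \<Rightarrow> complex" where
  "product_state \<phi> N X = the_elem (formal_state \<phi> N ` X)"

definition at_position :: "('a, 'm) star_algebra_scheme \<Rightarrow> nat \<Rightarrow> 'a \<Rightarrow> nat \<Rightarrow>
    ((nat \<Rightarrow> 'a) \<Rightarrow>\<^sub>0 complex) set" where
  "at_position A N b i = pure_tensor A N (\<lambda>j. if j = i then b else \<one>\<^bsub>A\<^esub>)"

definition increasing_indices :: "nat \<Rightarrow> nat \<Rightarrow> nat list set" where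
  "increasing_indices N n = {is. length is = n \<and> sorted_wrt (<) is \<and> set is \<subseteq> {1..N}}"

text \<open>
  The product is taken over the list in increasing order of positions, as the tensor power of a
  noncommutative algebra is not a commutative monoid.  For \<open>N < n\<close> the sum is empty.
\<close>

definition elementary_sum :: "('a, 'm) star_algebra_scheme \<Rightarrow> 'a \<Rightarrow> nat \<Rightarrow> nat \<Rightarrow>
    ((nat \<Rightarrow> 'a) \<Rightarrow>\<^sub>0 complex) set" where
  "elementary_sum A b N n =
     (\<Oplus>\<^bsub>tensor_power A N\<^esub> is \<in> increasing_indices N n.
        foldr (\<lambda>i t. at_position A N b i \<otimes>\<^bsub>tensor_power A N\<^esub> t) is \<one>\<^bsub>tensor_power A N\<^esub>)"

fun monic_hermite :: "nat \<Rightarrow> real poly" where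
  "monic_hermite 0 = 1"
| "monic_hermite (Suc 0) = [:0, 1:]"
| "monic_hermite (Suc (Suc n)) =
     [:0, 1:] * monic_hermite (Suc n) - of_nat (Suc n) * monic_hermite n"

text \<open>
  Everything below justifies the quotient constructions above: the operations on representatives
  respect the multilinearity relations, \<open>tensor_power A N\<close> is again a unital star algebra, and
  \<open>product_state \<phi> N\<close> is the linear functional given on pure tensors by the product of the values.
\<close>

declare One_nat_def [simp del]

lemma formal_induct [consumes 1, case_names zero single add]:
  fixes f :: "'k \<Rightarrow>\<^sub>0 complex"
  assumes "Poly_Mapping.keys f \<subseteq> T"
    and "P 0"
    and "\<And>x c. x \<in> T \<Longrightarrow> P (Poly_Mapping.single x c)"
    and "\<And>f g. P f \<Longrightarrow> P g \<Longrightarrow> P (f + g)"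
  shows "P f"
proof -
  have "P (\<Sum>k\<in>K. Poly_Mapping.single k (Poly_Mapping.lookup f k))" if "finite K" "K \<subseteq> T" for K
    using that by (induction K rule: finite_induct) (auto intro: assms)
  from this[OF finite_keys assms(1)] show ?thesis
  proof -
    have "(\<Sum>k\<in>Poly_Mapping.keys f. Poly_Mapping.single k (Poly_Mapping.lookup f k)) = f"
      by (rule poly_mapping_eqI)
        (simp add: lookup_sum lookup_single when_def sum.delta in_keys_iff)
    with \<open>P (\<Sum>k\<in>Poly_Mapping.keys f. Poly_Mapping.single k (Poly_Mapping.lookup f k))\<close> show ?thesis by simp
  qed
qed

lemma lookup_formal_scale: "Poly_Mapping.lookup (formal_scale c f) k = c * Poly_Mapping.lookup f k"
  unfolding formal_scale_def by transfer (simp add: when_def)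

lemma formal_scale_simps [simp]:
  "formal_scale c 0 = 0"
  "formal_scale c (f + g) = formal_scale c f + formal_scale c g"
  "formal_scale c (f - g) = formal_scale c f - formal_scale c g"
  "formal_scale (c + d) f = formal_scale c f + formal_scale d f"
  "formal_scale c (formal_scale d f) = formal_scale (c * d) f"
  "formal_scale 1 f = f"
  "formal_scale (-1) f = - f"
  "formal_scale c (Poly_Mapping.single x d) = Poly_Mapping.single x (c * d)"
  by (auto intro!: poly_mapping_eqI
      simp: lookup_formal_scale lookup_add lookup_minus lookup_single when_def algebra_simps)

lemma formal_mult_add_left:
  "formal_mult A N (f + f') g = formal_mult A N f g + formal_mult A N f' g"
  unfolding formal_mult_def
  by (rule setsum_keys_plus_distrib) (simp_all add: ring_distribs single_add sum.distrib)

lemma formal_mult_commute_sums: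
  "formal_mult A N f g = (\<Sum>y\<in>Poly_Mapping.keys g. \<Sum>x\<in>Poly_Mapping.keys f.
     Poly_Mapping.single (\<lambda>i\<in>{1..N}. x i \<otimes>\<^bsub>A\<^esub> y i)
       (Poly_Mapping.lookup f x * Poly_Mapping.lookup g y))"
  unfolding formal_mult_def by (rule sum.swap)

lemma formal_mult_add_right:
  "formal_mult A N f (g + g') = formal_mult A N f g + formal_mult A N f g'"
  unfolding formal_mult_commute_sums
  by (rule setsum_keys_plus_distrib) (simp_all add: ring_distribs single_add sum.distrib)

lemma formal_star_add: "formal_star A N (f + f') = formal_star A N f + formal_star A N f'"
  unfolding formal_star_def
  by (rule setsum_keys_plus_distrib) (simp_all add: single_add)

lemma formal_state_add: "formal_state \<phi> N (f + f') = formal_state \<phi> N f + formal_state \<phi> N f'"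
  unfolding formal_state_def
  by (rule setsum_keys_plus_distrib) (simp_all add: ring_distribs)

lemma formal_zero [simp]:
  "formal_mult A N 0 g = 0" "formal_mult A N f 0 = 0" "formal_star A N 0 = 0" "formal_state \<phi> N 0 = 0"
  by (simp_all add: formal_mult_def formal_star_def formal_state_def)

lemma formal_mult_diff_left:
  "formal_mult A N (f - f') g = formal_mult A N f g - formal_mult A N f' g"
  using formal_mult_add_left[of A N "f - f'" f' g] by (simp add: algebra_simps)

lemma formal_mult_diff_right:
  "formal_mult A N f (g - g') = formal_mult A N f g - formal_mult A N f g'"
  using formal_mult_add_right[of A N f "g - g'" g'] by (simp add: algebra_simps)

lemma formal_star_diff: "formal_star A N (f - f') = formal_star A N f - formal_star A N f'"
  using formal_star_add[of A N "f - f'" f'] by (simp add: algebra_simps)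

lemma formal_state_diff: "formal_state \<phi> N (f - f') = formal_state \<phi> N f - formal_state \<phi> N f'"
  using formal_state_add[of \<phi> N "f - f'" f'] by (simp add: algebra_simps)

lemma formal_mult_single:
  "formal_mult A N (Poly_Mapping.single x c) (Poly_Mapping.single y d)
     = Poly_Mapping.single (\<lambda>i\<in>{1..N}. x i \<otimes>\<^bsub>A\<^esub> y i) (c * d)"
  by (simp add: formal_mult_def)

lemma formal_star_single:
  "formal_star A N (Poly_Mapping.single x c) = Poly_Mapping.single (\<lambda>i\<in>{1..N}. star A (x i)) (cnj c)"
  by (simp add: formal_star_def)

lemma formal_state_single:
  "formal_state \<phi> N (Poly_Mapping.single x c) = c * (\<Prod>i\<in>{1..N}. \<phi> (x i))"
  by (simp add: formal_state_def)

lemmas formal_simps = formal_mult_add_left formal_mult_add_right formal_star_add formal_state_add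
  formal_mult_diff_left formal_mult_diff_right formal_star_diff formal_state_diff
  formal_mult_single formal_star_single formal_state_single

lemma formal_mult_scale_left:
  "formal_mult A N (formal_scale c f) g = formal_scale c (formal_mult A N f g)"
proof (induction f rule: formal_induct[OF subset_UNIV])
  case (2 x d)
  show ?case
    by (induction g rule: formal_induct[OF subset_UNIV]) (simp_all add: formal_simps mult.assoc mult.left_commute)
qed (simp_all add: formal_simps)

lemma formal_mult_scale_right:
  "formal_mult A N f (formal_scale c g) = formal_scale c (formal_mult A N f g)"
proof (induction f rule: formal_induct[OF subset_UNIV])
  case (2 x d)
  show ?case
    by (induction g rule: formal_induct[OF subset_UNIV]) (simp_all add: formal_simps mult.assoc mult.left_commute)
qed (simp_all add: formal_simps)

lemma formal_star_scale: "formal_star A N (formal_scale c f) = formal_scale (cnj c) (formal_star A N f)"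
  by (induction f rule: formal_induct[OF subset_UNIV]) (simp_all add: formal_simps)

lemma formal_state_scale: "formal_state \<phi> N (formal_scale c f) = c * formal_state \<phi> N f"
  by (induction f rule: formal_induct[OF subset_UNIV]) (simp_all add: formal_simps algebra_simps)

lemmas formal_scale_out =
  formal_mult_scale_left formal_mult_scale_right formal_star_scale formal_state_scale

lemma formal_tensors_induct [consumes 1, case_names zero single add]:
  assumes "f \<in> formal_tensors A N"
    and "P 0"
    and "\<And>x c. x \<in> tuples A N \<Longrightarrow> P (Poly_Mapping.single x c)"
    and "\<And>f g. P f \<Longrightarrow> P g \<Longrightarrow> P (f + g)"
  shows "P f"
  using assms unfolding formal_tensors_def by (auto intro: formal_induct[of f "tuples A N" P])

lemma tuple_upd: "x \<in> tuples A N \<Longrightarrow> i \<in> {1..N} \<Longrightarrow> a \<in> carrier A \<Longrightarrow> x(i := a) \<in> tuples A N"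
  unfolding tuples_def PiE_def extensional_def by auto

lemma tuple_D: "x \<in> tuples A N \<Longrightarrow> i \<in> {1..N} \<Longrightarrow> x i \<in> carrier A"
  unfolding tuples_def by auto

lemma restrict_tuple: "(\<And>i. i \<in> {1..N} \<Longrightarrow> x i \<in> carrier A) \<Longrightarrow> restrict x {1..N} \<in> tuples A N"
  unfolding tuples_def by auto

lemma formal_tensors_closed [intro]:
  "0 \<in> formal_tensors A N"
  "f \<in> formal_tensors A N \<Longrightarrow> g \<in> formal_tensors A N \<Longrightarrow> f + g \<in> formal_tensors A N"
  "f \<in> formal_tensors A N \<Longrightarrow> g \<in> formal_tensors A N \<Longrightarrow> f - g \<in> formal_tensors A N"
  "f \<in> formal_tensors A N \<Longrightarrow> - f \<in> formal_tensors A N"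
  "f \<in> formal_tensors A N \<Longrightarrow> formal_scale c f \<in> formal_tensors A N"
  "x \<in> tuples A N \<Longrightarrow> Poly_Mapping.single x c \<in> formal_tensors A N"
  unfolding formal_tensors_def
  by (auto simp: in_keys_iff lookup_add lookup_minus lookup_formal_scale subset_iff lookup_single when_def
      split: if_splits)
     (metis add.right_neutral diff_zero)+

lemma relations_uminus: "f \<in> multilinear_relations A N \<Longrightarrow> - f \<in> multilinear_relations A N"
  using multilinear_relations.scale[of f A N "-1"] by simp

lemma relations_diff:
  "f \<in> multilinear_relations A N \<Longrightarrow> g \<in> multilinear_relations A N \<Longrightarrow> f - g \<in> multilinear_relations A N"
  using multilinear_relations.add[OF _ relations_uminus] by fastforce

context unital_star_algebra
begin

lemma formal_mult_closed:
  assumes "f \<in> formal_tensors A N" "g \<in> formal_tensors A N"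
  shows "formal_mult A N f g \<in> formal_tensors A N"
  using assms(1)
proof (induction rule: formal_tensors_induct)
  case (single x c)
  show ?case using assms(2)
    by (induction rule: formal_tensors_induct)
      (use single in \<open>auto simp: formal_simps tuple_D intro!: formal_tensors_closed(6) restrict_tuple\<close>)
qed (auto simp: formal_simps)

lemma formal_star_closed:
  assumes "f \<in> formal_tensors A N"
  shows "formal_star A N f \<in> formal_tensors A N"
  using assms
  by (induction rule: formal_tensors_induct)
    (auto simp: formal_simps tuple_D intro!: formal_tensors_closed(6) restrict_tuple)

lemma relations_formal_mult_right:
  assumes "r \<in> multilinear_relations A N" "g \<in> formal_tensors A N"
  shows "formal_mult A N r g \<in> multilinear_relations A N"
  using assms
proof (induction rule: multilinear_relations.induct)
  case (additive x i a b)
  from additive(5) show ?case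
  proof (induction rule: formal_tensors_induct)
    case (single y d)
    define z where "z = (\<lambda>j\<in>{1..N}. x j \<otimes> y j)"
    have z: "z \<in> tuples A N" unfolding z_def
      by (intro restrict_tuple) (use additive single tuple_D in blast)
    have yi: "y i \<in> carrier A" using single additive by (auto intro: tuple_D)
    have upd: "(\<lambda>j\<in>{1..N}. (x(i := u)) j \<otimes> y j) = z(i := u \<otimes> y i)" for u
      using additive by (auto simp: z_def restrict_def)
    have "formal_scale d (Poly_Mapping.single (z(i := (a \<otimes> y i) \<oplus> (b \<otimes> y i))) 1
       - Poly_Mapping.single (z(i := a \<otimes> y i)) 1 - Poly_Mapping.single (z(i := b \<otimes> y i)) 1)
       \<in> multilinear_relations A N"
      by (intro multilinear_relations.scale multilinear_relations.additive z) (use additive yi in auto)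
    then show ?case
      using additive yi by (simp add: formal_simps upd l_distr del: restrict_apply fun_upd_apply)
  qed (auto simp: formal_mult_add_right intro: multilinear_relations.add multilinear_relations.zero)
next
  case (homogeneous x i a c)
  from homogeneous(4) show ?case
  proof (induction rule: formal_tensors_induct)
    case (single y d)
    define z where "z = (\<lambda>j\<in>{1..N}. x j \<otimes> y j)"
    have z: "z \<in> tuples A N" unfolding z_def
      by (intro restrict_tuple) (use homogeneous single tuple_D in blast)
    have yi: "y i \<in> carrier A" using single homogeneous by (auto intro: tuple_D)
    have upd: "(\<lambda>j\<in>{1..N}. (x(i := u)) j \<otimes> y j) = z(i := u \<otimes> y i)" for u
      using homogeneous by (auto simp: z_def restrict_def)
    have "formal_scale d (Poly_Mapping.single (z(i := c \<odot> (a \<otimes> y i))) 1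
       - Poly_Mapping.single (z(i := a \<otimes> y i)) c) \<in> multilinear_relations A N"
      by (intro multilinear_relations.scale multilinear_relations.homogeneous z) (use homogeneous yi in auto)
    then show ?case
      using homogeneous yi by (simp add: formal_simps upd mult_scale_left mult.commute del: restrict_apply fun_upd_apply)
  qed (auto simp: formal_mult_add_right intro: multilinear_relations.add multilinear_relations.zero)
qed (auto simp: formal_simps formal_scale_out intro: multilinear_relations.intros)

lemma relations_formal_mult_left:
  assumes "r \<in> multilinear_relations A N" "g \<in> formal_tensors A N"
  shows "formal_mult A N g r \<in> multilinear_relations A N"
  using assms
proof (induction rule: multilinear_relations.induct)
  case (additive x i a b)
  from additive(5) show ?case
  proof (induction rule: formal_tensors_induct)
    case (single y d)
    define z where "z = (\<lambda>j\<in>{1..N}. y j \<otimes> x j)"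
    have z: "z \<in> tuples A N" unfolding z_def
      by (intro restrict_tuple) (use additive single tuple_D in blast)
    have yi: "y i \<in> carrier A" using single additive by (auto intro: tuple_D)
    have upd: "(\<lambda>j\<in>{1..N}. y j \<otimes> (x(i := u)) j) = z(i := y i \<otimes> u)" for u
      using additive by (auto simp: z_def restrict_def)
    have "formal_scale d (Poly_Mapping.single (z(i := (y i \<otimes> a) \<oplus> (y i \<otimes> b))) 1
       - Poly_Mapping.single (z(i := y i \<otimes> a)) 1 - Poly_Mapping.single (z(i := y i \<otimes> b)) 1)
       \<in> multilinear_relations A N"
      by (intro multilinear_relations.scale multilinear_relations.additive z) (use additive yi in auto)
    then show ?case
      using additive yi by (simp add: formal_simps upd r_distr del: restrict_apply fun_upd_apply)
  qed (auto simp: formal_mult_add_left intro: multilinear_relations.add multilinear_relations.zero)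
next
  case (homogeneous x i a c)
  from homogeneous(4) show ?case
  proof (induction rule: formal_tensors_induct)
    case (single y d)
    define z where "z = (\<lambda>j\<in>{1..N}. y j \<otimes> x j)"
    have z: "z \<in> tuples A N" unfolding z_def
      by (intro restrict_tuple) (use homogeneous single tuple_D in blast)
    have yi: "y i \<in> carrier A" using single homogeneous by (auto intro: tuple_D)
    have upd: "(\<lambda>j\<in>{1..N}. y j \<otimes> (x(i := u)) j) = z(i := y i \<otimes> u)" for u
      using homogeneous by (auto simp: z_def restrict_def)
    have "formal_scale d (Poly_Mapping.single (z(i := c \<odot> (y i \<otimes> a))) 1
       - Poly_Mapping.single (z(i := y i \<otimes> a)) c) \<in> multilinear_relations A N"
      by (intro multilinear_relations.scale multilinear_relations.homogeneous z) (use homogeneous yi in auto)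
    then show ?case
      using homogeneous yi by (simp add: formal_simps upd mult_scale_right mult.commute del: restrict_apply fun_upd_apply)
  qed (auto simp: formal_mult_add_left intro: multilinear_relations.add multilinear_relations.zero)
qed (auto simp: formal_simps formal_scale_out intro: multilinear_relations.intros)

lemma relations_formal_star:
  assumes "r \<in> multilinear_relations A N"
  shows "formal_star A N r \<in> multilinear_relations A N"
  using assms
proof (induction rule: multilinear_relations.induct)
  case (additive x i a b)
  define z where "z = (\<lambda>j\<in>{1..N}. star A (x j))"
  have z: "z \<in> tuples A N" unfolding z_def
    by (intro restrict_tuple) (use additive tuple_D in blast)
  have upd: "(\<lambda>j\<in>{1..N}. star A ((x(i := u)) j)) = z(i := star A u)" for u
    using additive by (auto simp: z_def restrict_def)
  show ?case
    using multilinear_relations.additive[OF z additive(2), of "star A a" "star A b"] additive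
    by (simp add: formal_simps upd star_add del: restrict_apply fun_upd_apply)
next
  case (homogeneous x i a c)
  define z where "z = (\<lambda>j\<in>{1..N}. star A (x j))"
  have z: "z \<in> tuples A N" unfolding z_def
    by (intro restrict_tuple) (use homogeneous tuple_D in blast)
  have upd: "(\<lambda>j\<in>{1..N}. star A ((x(i := u)) j)) = z(i := star A u)" for u
    using homogeneous by (auto simp: z_def restrict_def)
  show ?case
    using multilinear_relations.homogeneous[OF z homogeneous(2), of "star A a" "cnj c"] homogeneous
    by (simp add: formal_simps upd star_scale del: restrict_apply fun_upd_apply)
qed (auto simp: formal_simps formal_scale_out intro: multilinear_relations.intros)

lemma equiv_tensor_eq: "equiv (formal_tensors A N) (tensor_eq A N)"
proof (rule equivI)
  show "refl_on (formal_tensors A N) (tensor_eq A N)"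
    by (auto simp: refl_on_def tensor_eq_def intro: multilinear_relations.zero)
  show "sym (tensor_eq A N)"
    by (rule symI) (auto simp: tensor_eq_def dest: relations_uminus)
  show "trans (tensor_eq A N)"
    by (rule transI) (auto simp: tensor_eq_def, drule (1) multilinear_relations.add, simp)
qed (auto simp: tensor_eq_def)

lemma tensor_class_eq_iff:
  "f \<in> formal_tensors A N \<Longrightarrow> g \<in> formal_tensors A N \<Longrightarrow>
     tensor_class A N f = tensor_class A N g \<longleftrightarrow> f - g \<in> multilinear_relations A N"
  unfolding tensor_class_def by (subst eq_equiv_class_iff[OF equiv_tensor_eq]) (auto simp: tensor_eq_def)

lemma tensor_eqD:
  "(f, g) \<in> tensor_eq A N \<Longrightarrow>
     f \<in> formal_tensors A N \<and> g \<in> formal_tensors A N \<and> f - g \<in> multilinear_relations A N"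
  by (simp add: tensor_eq_def)

lemma tensor_power_mult_class:
  assumes "f \<in> formal_tensors A N" "g \<in> formal_tensors A N"
  shows "tensor_class A N f \<otimes>\<^bsub>tensor_power A N\<^esub> tensor_class A N g
    = tensor_class A N (formal_mult A N f g)"
proof -
  have "congruent2 (tensor_eq A N) (tensor_eq A N) (\<lambda>f g. tensor_class A N (formal_mult A N f g))"
  proof (rule congruent2I'; drule tensor_eqD; drule tensor_eqD; elim conjE)
    fix f f' g g'
    assume *: "f \<in> formal_tensors A N" "f' \<in> formal_tensors A N" "f - f' \<in> multilinear_relations A N"
      "g \<in> formal_tensors A N" "g' \<in> formal_tensors A N" "g - g' \<in> multilinear_relations A N"
    have "formal_mult A N f g - formal_mult A N f' g' = formal_mult A N (f - f') g + formal_mult A N f' (g - g')"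
      by (simp add: formal_simps)
    also have "\<dots> \<in> multilinear_relations A N"
      by (intro multilinear_relations.add relations_formal_mult_left relations_formal_mult_right *)
    finally show "tensor_class A N (formal_mult A N f g) = tensor_class A N (formal_mult A N f' g')"
      by (simp add: tensor_class_eq_iff formal_mult_closed *)
  qed
  from UN_equiv_class2[OF equiv_tensor_eq equiv_tensor_eq this assms] show ?thesis
    by (simp add: tensor_power_def tensor_class_def)
qed

lemma tensor_power_add_class:
  assumes "f \<in> formal_tensors A N" "g \<in> formal_tensors A N"
  shows "tensor_class A N f \<oplus>\<^bsub>tensor_power A N\<^esub> tensor_class A N g = tensor_class A N (f + g)"
proof -
  have "congruent2 (tensor_eq A N) (tensor_eq A N) (\<lambda>f g. tensor_class A N (f + g))"
  proof (rule congruent2I'; drule tensor_eqD; drule tensor_eqD; elim conjE)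
    fix f f' g g'
    assume *: "f \<in> formal_tensors A N" "f' \<in> formal_tensors A N" "f - f' \<in> multilinear_relations A N"
      "g \<in> formal_tensors A N" "g' \<in> formal_tensors A N" "g - g' \<in> multilinear_relations A N"
    have "(f + g) - (f' + g') = (f - f') + (g - g')" by simp
    also have "\<dots> \<in> multilinear_relations A N"
      by (intro multilinear_relations.add *)
    finally show "tensor_class A N (f + g) = tensor_class A N (f' + g')"
      by (subst tensor_class_eq_iff) (auto intro: *)
  qed
  from UN_equiv_class2[OF equiv_tensor_eq equiv_tensor_eq this assms] show ?thesis
    by (simp add: tensor_power_def tensor_class_def)
qed

lemma tensor_power_scale_class:
  assumes "f \<in> formal_tensors A N"
  shows "c \<odot>\<^bsub>tensor_power A N\<^esub> tensor_class A N f = tensor_class A N (formal_scale c f)"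
proof -
  have "congruent (tensor_eq A N) (\<lambda>f. tensor_class A N (formal_scale c f))"
  proof (rule congruentI; drule tensor_eqD; elim conjE)
    fix f f'
    assume *: "f \<in> formal_tensors A N" "f' \<in> formal_tensors A N" "f - f' \<in> multilinear_relations A N"
    have "formal_scale c f - formal_scale c f' \<in> multilinear_relations A N"
      using multilinear_relations.scale[OF *(3), of c] by simp
    then show "tensor_class A N (formal_scale c f) = tensor_class A N (formal_scale c f')"
      by (subst tensor_class_eq_iff) (auto intro: *)
  qed
  from UN_equiv_class[OF equiv_tensor_eq this assms] show ?thesis
    by (simp add: tensor_power_def tensor_class_def)
qed

lemma tensor_power_star_class:
  assumes "f \<in> formal_tensors A N"
  shows "star (tensor_power A N) (tensor_class A N f) = tensor_class A N (formal_star A N f)"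
proof -
  have "congruent (tensor_eq A N) (\<lambda>f. tensor_class A N (formal_star A N f))"
  proof (rule congruentI; drule tensor_eqD; elim conjE)
    fix f f'
    assume *: "f \<in> formal_tensors A N" "f' \<in> formal_tensors A N" "f - f' \<in> multilinear_relations A N"
    have "formal_star A N f - formal_star A N f' \<in> multilinear_relations A N"
      using relations_formal_star[OF *(3)] by (simp add: formal_simps)
    then show "tensor_class A N (formal_star A N f) = tensor_class A N (formal_star A N f')"
      by (subst tensor_class_eq_iff) (auto intro: * formal_star_closed)
  qed
  from UN_equiv_class[OF equiv_tensor_eq this assms] show ?thesis
    by (simp add: tensor_power_def tensor_class_def)
qed

definition formal_one :: "nat \<Rightarrow> (nat \<Rightarrow> 'a) \<Rightarrow>\<^sub>0 complex" where
  "formal_one N = Poly_Mapping.single (\<lambda>i\<in>{1..N}. \<one>) 1"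

lemma formal_one_closed: "formal_one N \<in> formal_tensors A N"
  unfolding formal_one_def by (auto intro: restrict_tuple)

lemma tuple_ext: "x \<in> tuples A N \<Longrightarrow> (\<And>i. i \<in> {1..N} \<Longrightarrow> f i = x i) \<Longrightarrow> restrict f {1..N} = x"
  by (auto simp: tuples_def restrict_def PiE_def extensional_def)

lemma formal_mult_one:
  assumes "f \<in> formal_tensors A N"
  shows "formal_mult A N (formal_one N) f = f" "formal_mult A N f (formal_one N) = f"
  using assms
  by (induction rule: formal_tensors_induct)
    (auto simp: formal_simps formal_one_def tuple_D intro!: tuple_ext arg_cong2[of _ _ _ _ Poly_Mapping.single])

lemma formal_mult_assoc:
  assumes f: "f \<in> formal_tensors A N" and g: "g \<in> formal_tensors A N" and h: "h \<in> formal_tensors A N"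
  shows "formal_mult A N (formal_mult A N f g) h = formal_mult A N f (formal_mult A N g h)"
  using f
proof (induction rule: formal_tensors_induct)
  case x: (single x c)
  show ?case using g
  proof (induction rule: formal_tensors_induct)
    case y: (single y d)
    show ?case using h
    proof (induction rule: formal_tensors_induct)
      case (single z e)
      show ?case using x y single
        by (auto simp: formal_simps tuple_D m_assoc algebra_simps intro!: arg_cong2[of _ _ _ _ Poly_Mapping.single])
    qed (auto simp: formal_simps)
  qed (auto simp: formal_simps)
qed (auto simp: formal_simps)

lemma formal_star_star:
  assumes "f \<in> formal_tensors A N"
  shows "formal_star A N (formal_star A N f) = f"
  using assms
  by (induction rule: formal_tensors_induct)
    (auto simp: formal_simps tuple_D star_star intro!: tuple_ext arg_cong2[of _ _ _ _ Poly_Mapping.single])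

lemma formal_star_mult:
  assumes f: "f \<in> formal_tensors A N" and g: "g \<in> formal_tensors A N"
  shows "formal_star A N (formal_mult A N f g) = formal_mult A N (formal_star A N g) (formal_star A N f)"
  using f
proof (induction rule: formal_tensors_induct)
  case x: (single x c)
  show ?case using g
  proof (induction rule: formal_tensors_induct)
    case y: (single y d)
    show ?case using x y
      by (auto simp: formal_simps tuple_D star_mult intro!: arg_cong2[of _ _ _ _ Poly_Mapping.single])
  qed (auto simp: formal_simps)
qed (auto simp: formal_simps)

lemma tensor_class_closed [intro]:
  "f \<in> formal_tensors A N \<Longrightarrow> tensor_class A N f \<in> carrier (tensor_power A N)"
  by (simp add: tensor_power_def tensor_class_def quotientI)

lemma tensor_powerE:
  assumes "X \<in> carrier (tensor_power A N)"
  obtains f where "f \<in> formal_tensors A N" "X = tensor_class A N f"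
  using assms by (auto simp: tensor_power_def tensor_class_def elim!: quotientE)

lemma tensor_power_one_zero:
  "\<one>\<^bsub>tensor_power A N\<^esub> = tensor_class A N (formal_one N)"
  "\<zero>\<^bsub>tensor_power A N\<^esub> = tensor_class A N 0"
  by (simp_all add: tensor_power_def pure_tensor_def formal_one_def)

lemmas tensor_class_ops = tensor_power_mult_class tensor_power_add_class tensor_power_scale_class
  tensor_power_star_class tensor_power_one_zero

theorem tensor_power_unital_star_algebra: "unital_star_algebra (tensor_power A N)"
proof -
  let ?T = "tensor_power A N"
  note [simp] = tensor_class_ops tensor_class_closed formal_mult_closed formal_star_closed formal_one_closed
    formal_tensors_closed
  have "ring ?T"
  proof (rule ringI)
    show "abelian_group ?T"
    proof (rule abelian_groupI)
      fix X assume "X \<in> carrier ?T"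
      then show "\<exists>Y\<in>carrier ?T. Y \<oplus>\<^bsub>?T\<^esub> X = \<zero>\<^bsub>?T\<^esub>"
      proof (cases rule: tensor_powerE)
        case (1 f)
        then show ?thesis
          by (intro bexI[of _ "tensor_class A N (- f)"]) auto
      qed
    qed (auto elim!: tensor_powerE simp: algebra_simps)
    show "monoid ?T"
      by (rule monoidI) (auto elim!: tensor_powerE simp: formal_mult_one formal_mult_assoc)
  qed (auto elim!: tensor_powerE simp: formal_simps)
  then show ?thesis
    by (intro unital_star_algebra.intro unital_star_algebra_axioms.intro)
      (auto elim!: tensor_powerE simp: formal_simps formal_scale_out formal_star_star formal_star_mult)
qed

lemma pure_tensor_closed:
  "(\<And>i. i \<in> {1..N} \<Longrightarrow> x i \<in> carrier A) \<Longrightarrow> pure_tensor A N x \<in> carrier (tensor_power A N)"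
  unfolding pure_tensor_def by (auto intro!: tensor_class_closed formal_tensors_closed(6) restrict_tuple)

lemma pure_tensor_mult:
  assumes "\<And>i. i \<in> {1..N} \<Longrightarrow> x i \<in> carrier A" "\<And>i. i \<in> {1..N} \<Longrightarrow> y i \<in> carrier A"
  shows "pure_tensor A N x \<otimes>\<^bsub>tensor_power A N\<^esub> pure_tensor A N y = pure_tensor A N (\<lambda>i. x i \<otimes> y i)"
  unfolding pure_tensor_def using assms
  by (subst tensor_power_mult_class)
    (auto simp: formal_simps intro!: formal_tensors_closed(6) restrict_tuple arg_cong[of _ _ "tensor_class A N"]
      arg_cong2[of _ _ _ _ Poly_Mapping.single])

end

context algebraic_probability_space
begin

lemma formal_state_relations:
  assumes "r \<in> multilinear_relations A N"
  shows "formal_state \<phi> N r = 0"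
proof -
  have upd: "(\<Prod>j\<in>{1..N}. \<phi> ((x(i := u)) j)) = \<phi> u * (\<Prod>j\<in>{1..N} - {i}. \<phi> (x j))"
    if "i \<in> {1..N}" for x i u
    using that by (subst prod.remove[of _ i]) auto
  show ?thesis using assms
    by (induction rule: multilinear_relations.induct)
      (simp_all only: formal_simps formal_scale_out upd state_add state_scale formal_zero, simp_all add: algebra_simps)
qed

lemma product_state_class:
  assumes "f \<in> formal_tensors A N"
  shows "product_state \<phi> N (tensor_class A N f) = formal_state \<phi> N f"
proof -
  have "formal_state \<phi> N ` tensor_class A N f = {formal_state \<phi> N f}"
  proof
    show "formal_state \<phi> N ` tensor_class A N f \<subseteq> {formal_state \<phi> N f}"
      using formal_state_relations
      by (force simp: tensor_class_def tensor_eq_def formal_state_diff)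
    show "{formal_state \<phi> N f} \<subseteq> formal_state \<phi> N ` tensor_class A N f"
      using equiv_class_self[OF equiv_tensor_eq assms] by (auto simp: tensor_class_def)
  qed
  then show ?thesis by (simp add: product_state_def)
qed

lemma product_state_pure_tensor:
  assumes "\<And>i. i \<in> {1..N} \<Longrightarrow> x i \<in> carrier A"
  shows "product_state \<phi> N (pure_tensor A N x) = (\<Prod>i\<in>{1..N}. \<phi> (x i))"
  unfolding pure_tensor_def using assms
  by (subst product_state_class) (auto simp: formal_simps intro!: formal_tensors_closed(6) restrict_tuple)

lemma product_state_add:
  assumes "X \<in> carrier (tensor_power A N)" "Y \<in> carrier (tensor_power A N)"
  shows "product_state \<phi> N (X \<oplus>\<^bsub>tensor_power A N\<^esub> Y) = product_state \<phi> N X + product_state \<phi> N Y"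
  using assms by (auto elim!: tensor_powerE
      simp: tensor_class_ops product_state_class formal_simps formal_tensors_closed)

lemma product_state_scale:
  assumes "X \<in> carrier (tensor_power A N)"
  shows "product_state \<phi> N (c \<odot>\<^bsub>tensor_power A N\<^esub> X) = c * product_state \<phi> N X"
  using assms by (auto elim!: tensor_powerE
      simp: tensor_class_ops product_state_class formal_scale_out formal_tensors_closed)

lemma product_state_one: "product_state \<phi> N \<one>\<^bsub>tensor_power A N\<^esub> = 1"
  by (simp add: tensor_power_one_zero product_state_class formal_one_closed)
    (simp add: formal_one_def formal_simps state_one)

end
declare One_nat_def [simp]

end

theory Submission
  imports Defs "HOL-Real_Asymp.Real_Asymp"
begin

text \<open>
  Write \<open>F\<^sub>N(n\<^sub>1, \<dots>, n\<^sub>m)\<close> for the state of the product of the elementary symmetric polynomials \<open>e(n\<^sub>j)\<close>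
  in \<open>b(1), \<dots>, b(N)\<close>, and \<open>h\<^sub>n\<close> for the \<open>n\<close>-th Hermite polynomial divided by \<open>n!\<close>.  Splitting off the
  last position gives
  \<open>F\<^sub>N\<^sub>+\<^sub>1(n) = \<Sum>\<^sub>T \<phi>(b\<^sup>t) F\<^sub>N(n - 1\<^sub>T)\<close>, where \<open>T\<close> runs over the sets of indices and \<open>t = |T|\<close>.  The terms
  with \<open>t = 1\<close> vanish and those with \<open>t \<ge> 3\<close> are of lower order, so by induction on \<open>s = n\<^sub>1 + \<dots> + n\<^sub>m\<close> and
  the Stolz--Cesaro theorem \<open>F\<^sub>N(n) / N\<^bsup>s/2\<^esup>\<close> has a limit \<open>L(n)\<close> with
  \<open>s L(n) = 2 \<Sum>\<^sub>T L(n - 1\<^sub>T)\<close>, the sum being over \<open>T\<close> of size 2.  The numbers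
  \<open>E[\<Prod>\<^sub>j h\<^bsub>n\<^sub>j\<^esub>(g)]\<close> obey the same recursion: the equation \<open>n h\<^sub>n = x h\<^sub>n' - h\<^sub>n''\<close> and \<open>h\<^sub>n' = h\<^sub>n\<^sub>-\<^sub>1\<close> show
  that \<open>P = \<Prod>\<^sub>j h\<^bsub>n\<^sub>j\<^esub>\<close> satisfies
  \<open>s P = x P' - P'' + 2 \<Sum>\<^sub>T \<Prod>\<^sub>j h\<^bsub>(n - 1\<^sub>T)\<^sub>j\<^esub>\<close>, and \<open>E[g P'(g)] = E[P''(g)]\<close>.
\<close>

section \<open>Stolz--Cesaro and sequences of power growth\<close>

text \<open>Eventually the increments of \<open>a n - b n *\<^sub>R l\<close> are at most
  \<open>e / 2\<close> times those of \<open>b\<close>. Telescoping bounds this difference by a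
  constant plus \<open>e / 2 * b n\<close>, and the constant is absorbed as \<open>b\<close> grows.
  The values lie in a normed space because the moments are complex.\<close>

lemma stolz_cesaro:
  fixes a :: "nat \<Rightarrow> 'a::real_normed_vector" and b :: "nat \<Rightarrow> real"
  assumes mono: "\<And>n. b n < b (Suc n)" and top: "filterlim b at_top sequentially"
    and lim: "(\<lambda>n. (a (Suc n) - a n) /\<^sub>R (b (Suc n) - b n)) \<longlonglongrightarrow> l"
  shows "(\<lambda>n. a n /\<^sub>R b n) \<longlonglongrightarrow> l"
proof (rule LIMSEQ_I)
  fix e :: real assume e: "e > 0"
  define d where "d n = a n - b n *\<^sub>R l" for n
  obtain n0 where n0: "\<And>n. n \<ge> n0 \<Longrightarrow> norm ((a (Suc n) - a n) /\<^sub>R (b (Suc n) - b n) - l) < e / 2"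
    using LIMSEQ_D[OF lim, of "e / 2"] e by auto
  have increment: "norm (d (Suc n) - d n) \<le> e / 2 * (b (Suc n) - b n)" if "n \<ge> n0" for n
  proof -
    have pos: "b (Suc n) - b n > 0" using mono[of n] by simp
    have "d (Suc n) - d n = (b (Suc n) - b n) *\<^sub>R ((a (Suc n) - a n) /\<^sub>R (b (Suc n) - b n) - l)"
      using pos by (simp add: d_def scaleR_diff_right scaleR_diff_left)
    then have "norm (d (Suc n) - d n)
        = (b (Suc n) - b n) * norm ((a (Suc n) - a n) /\<^sub>R (b (Suc n) - b n) - l)"
      using pos by simp
    also have "\<dots> \<le> (b (Suc n) - b n) * (e / 2)"
      using n0[OF that] pos by (intro mult_left_mono) auto
    finally show ?thesis by (simp add: mult.commute)
  qed
  have bound: "norm (d n) \<le> norm (d n0) + e / 2 * (b n - b n0)" if "n \<ge> n0" for n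
    using that
  proof (induction n rule: dec_induct)
    case (step n)
    have "norm (d (Suc n)) \<le> norm (d n) + norm (d (Suc n) - d n)"
      by (metis add.commute diff_add_cancel norm_triangle_ineq)
    with step.IH increment[OF step.hyps(1)] show ?case by (simp add: field_simps)
  qed simp
  \<comment> \<open>Beyond this threshold the constant is less than \<open>e / 2 * b n\<close>; the
    \<open>1\<close> keeps the divisor \<open>b n\<close> positive.\<close>
  have "eventually (\<lambda>n. b n > max 1 (2 * (norm (d n0) + e / 2 * \<bar>b n0\<bar>) / e)) sequentially"
    using top unfolding filterlim_at_top_dense by blast
  then obtain n1 where n1: "\<And>n. n \<ge> n1 \<Longrightarrow> b n > max 1 (2 * (norm (d n0) + e / 2 * \<bar>b n0\<bar>) / e)"
    by (auto simp: eventually_sequentially)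
  show "\<exists>no. \<forall>n\<ge>no. norm (a n /\<^sub>R b n - l) < e"
  proof (intro exI allI impI)
    fix n assume "n \<ge> max n0 n1"
    then have n: "n \<ge> n0" "b n > 1" "2 * (norm (d n0) + e / 2 * \<bar>b n0\<bar>) / e < b n"
      using n1[of n] by auto
    have "2 * (norm (d n0) + e / 2 * \<bar>b n0\<bar>) < b n * e"
      using n(3) e by (simp add: pos_divide_less_eq)
    moreover have "e / 2 * - b n0 \<le> e / 2 * \<bar>b n0\<bar>"
      using e by (intro mult_left_mono) auto
    ultimately have "norm (d n) < b n * e"
      using bound[OF n(1)] by (simp add: field_simps)
    moreover have "a n /\<^sub>R b n - l = d n /\<^sub>R b n"
      using n(2) by (simp add: d_def scaleR_diff_right)
    ultimately show "norm (a n /\<^sub>R b n - l) < e"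
      using n(2) by (simp add: divide_simps mult.commute)
  qed
qed

text \<open>The increments of \<open>real n powr s\<close> are asymptotic to
  \<open>s * real n powr (s - 1)\<close>, which produces the division by \<open>s\<close>.\<close>

lemma tendsto_powr_of_differences:
  fixes a :: "nat \<Rightarrow> complex"
  assumes "s > 0" and "(\<lambda>n. (a (Suc n) - a n) / of_real (real n powr (s - 1))) \<longlonglongrightarrow> l"
  shows "(\<lambda>n. a n / of_real (real n powr s)) \<longlonglongrightarrow> l / of_real s"
proof -
  have "(\<lambda>n. real n powr (s - 1) / (real (Suc n) powr s - real n powr s)) \<longlonglongrightarrow> inverse s"
    using assms(1) by real_asymp
  from tendsto_mult[OF assms(2) tendsto_of_real[OF this]]
  have "(\<lambda>n. (a (Suc n) - a n) / of_real (real n powr (s - 1))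
      * of_real (real n powr (s - 1) / (real (Suc n) powr s - real n powr s))) \<longlonglongrightarrow> l / of_real s"
    by (simp add: field_simps)
  moreover have "\<forall>\<^sub>F n in sequentially. (a (Suc n) - a n) / of_real (real n powr (s - 1))
      * of_real (real n powr (s - 1) / (real (Suc n) powr s - real n powr s))
      = (a (Suc n) - a n) /\<^sub>R (real (Suc n) powr s - real n powr s)"
    using eventually_gt_at_top[of 0]
    by eventually_elim (simp add: scaleR_conv_of_real divide_inverse)
  ultimately have "(\<lambda>n. (a (Suc n) - a n) /\<^sub>R (real (Suc n) powr s - real n powr s)) \<longlonglongrightarrow> l / of_real s"
    by (rule Lim_transform_eventually)
  then have "(\<lambda>n. a n /\<^sub>R (real n powr s)) \<longlonglongrightarrow> l / of_real s"
  proof (rule stolz_cesaro[rotated 2])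
    show "real n powr s < real (Suc n) powr s" for n
      using assms(1) by (intro powr_less_mono2) auto
    show "filterlim (\<lambda>n. real n powr s) at_top sequentially"
      using assms(1) by real_asymp
  qed
  then show ?thesis by (simp add: scaleR_conv_of_real divide_simps mult.commute)
qed

section \<open>Gaussian expectations of polynomials\<close>

lemma poly_monom_induct [case_names zero monom add]:
  fixes p :: "'a::comm_monoid_add poly"
  assumes "P 0" and "\<And>c k. P (monom c k)" and "\<And>p q. P p \<Longrightarrow> P q \<Longrightarrow> P (p + q)"
  shows "P p"
proof -
  have "P (\<Sum>k\<in>K. monom (coeff p k) k)" if "finite K" for K
    using that by (induction K rule: finite_induct) (auto intro: assms)
  from this[of "{..degree p}"] show ?thesis by (simp add: poly_as_sum_of_monoms)
qed

definition gauss_poly :: "real poly \<Rightarrow> real" where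
  "gauss_poly p = (\<integral>x. std_normal_density x * poly p x \<partial>lborel)"

lemma integrable_gauss_poly: "integrable lborel (\<lambda>x. std_normal_density x * poly p x)"
proof (induction p rule: poly_monom_induct)
  case (monom c k)
  show ?case
    using integrable_mult_right[OF integrable_std_normal_moment[of k], of c]
    by (simp add: poly_monom mult_ac)
qed (simp_all add: ring_distribs)

lemma gauss_poly_simps:
  "gauss_poly 0 = 0"
  "gauss_poly (p + q) = gauss_poly p + gauss_poly q"
  "gauss_poly (p - q) = gauss_poly p - gauss_poly q"
  "gauss_poly (Polynomial.smult c p) = c * gauss_poly p"
  using integrable_gauss_poly[of p] integrable_gauss_poly[of q]
  by (simp_all add: gauss_poly_def ring_distribs mult.left_commute)

lemma gauss_poly_monom_even: "gauss_poly (monom 1 (2 * k)) = fact (2 * k) / (2 ^ k * fact k)"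
  using integral_std_normal_moment_even[of k] by (simp add: gauss_poly_def poly_monom)

lemma gauss_poly_monom_odd: "gauss_poly (monom 1 (2 * k + 1)) = 0"
  using integral_std_normal_moment_odd[of k] by (simp add: gauss_poly_def poly_monom)

lemma gauss_poly_one: "gauss_poly 1 = 1"
  using gauss_poly_monom_even[of 0] by (simp add: monom_0 one_pCons)

text \<open>Gaussian integration by parts. By linearity it is enough to treat monomials, where it is
  the recursion of the normal moments: the moment of order \<open>k + 1\<close> is \<open>k\<close>
  times that of order \<open>k - 1\<close>.\<close>

lemma gauss_poly_x_mult: "gauss_poly ([:0, 1:] * p) = gauss_poly (pderiv p)"
proof (induction p rule: poly_monom_induct)
  case (monom c k)
  have shift: "[:0, 1:] * monom c k = Polynomial.smult c (monom 1 (Suc k))"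
    by (simp add: smult_monom monom_Suc)
  have deriv: "pderiv (monom c k) = Polynomial.smult (c * of_nat k) (monom 1 (k - 1))"
    by (simp add: pderiv_monom smult_monom mult.commute)
  have "gauss_poly (monom 1 (Suc k)) = of_nat k * gauss_poly (monom 1 (k - 1))"
  proof (cases "even k")
    case True
    then obtain j where j: "k = 2 * j" by (auto elim: evenE)
    show ?thesis
    proof (cases j)
      \<comment> \<open>For \<open>k = 0\<close> the truncated \<open>k - 1\<close> is harmless,
        since the factor \<open>of_nat k\<close> vanishes.\<close>
      case 0
      then show ?thesis using j gauss_poly_monom_odd[of 0] by simp
    next
      case (Suc i)
      then have "k - 1 = 2 * i + 1" using j by simp
      then show ?thesis using j gauss_poly_monom_odd[of i] gauss_poly_monom_odd[of j] by simp
    qed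
  next
    case False
    then obtain j where j: "k = 2 * j + 1" by (auto elim: oddE)
    have "gauss_poly (monom 1 (2 * Suc j)) = of_nat (2 * j + 1) * gauss_poly (monom 1 (2 * j))"
    proof -
      have "fact (2 * Suc j) = real (2 * Suc j) * real (2 * j + 1) * fact (2 * j)"
        by (simp add: algebra_simps)
      then show ?thesis unfolding gauss_poly_monom_even
        by (simp add: divide_simps del: fact_Suc of_nat_Suc mult_Suc_right) (simp add: algebra_simps)
    qed
    then show ?thesis using j by simp
  qed
  then show ?case unfolding shift deriv by (simp add: gauss_poly_simps)
next
  case (add p q)
  then show ?case unfolding distrib_left pderiv_add gauss_poly_simps by simp
qed (simp add: gauss_poly_simps)

lemma distributed_std_normal_poly:
  assumes "distributed M lborel g std_normal_density"
  shows "(\<integral>\<omega>. poly p (g \<omega>) \<partial>M) = gauss_poly p"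
proof -
  have "(\<lambda>x. poly p x) \<in> borel_measurable lborel"
    by (auto intro!: borel_measurable_continuous_onI continuous_intros)
  with assms show ?thesis
    unfolding gauss_poly_def by (subst distributed_integral) auto
qed

section \<open>Normalised Hermite polynomials\<close>

text \<open>With the factor \<open>1 / fact n\<close>, differentiation is a pure shift of the
  index.\<close>

definition hermite :: "nat \<Rightarrow> real poly" where
  "hermite n = Polynomial.smult (1 / fact n) (monic_hermite n)"

text \<open>Differentiating the three-term recurrence at \<open>n = k + 1\<close> leaves
  \<open>monic_hermite (Suc k)\<close> plus \<open>Suc k\<close> times an expression that the
  recurrence identifies as \<open>monic_hermite (Suc k)\<close> again.\<close>

lemma pderiv_monic_hermite:
  "pderiv (monic_hermite (Suc n)) = Polynomial.smult (of_nat (Suc n)) (monic_hermite n)"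
proof (induction n rule: less_induct)
  case (less n)
  show ?case
  proof (cases n)
    case 0
    then show ?thesis by (simp add: pderiv_pCons one_pCons)
  next
    case (Suc k)
    have IH: "pderiv (monic_hermite (Suc k)) = Polynomial.smult (of_nat (Suc k)) (monic_hermite k)"
      using less.IH[of k] Suc by simp
    have rec: "pderiv (monic_hermite k) = Polynomial.smult (of_nat k) (monic_hermite (k - 1))"
      using less.IH[of "k - 1"] Suc by (cases k) auto
    have expand: "monic_hermite (Suc k) = [:0, 1:] * monic_hermite k - Polynomial.smult (of_nat k) (monic_hermite (k - 1))"
      by (cases k) (simp_all add: of_nat_poly)
    have "pderiv (monic_hermite (Suc n))
        = monic_hermite (Suc k) + [:0, 1:] * Polynomial.smult (of_nat (Suc k)) (monic_hermite k)
          - Polynomial.smult (of_nat (Suc k)) (Polynomial.smult (of_nat k) (monic_hermite (k - 1)))"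
      unfolding Suc monic_hermite.simps(3) pderiv_diff pderiv_mult IH
      by (simp add: pderiv_pCons of_nat_poly rec pderiv_smult mult.commute[of "1 + real k"] del: monic_hermite.simps)
    also have "\<dots> = monic_hermite (Suc k) + Polynomial.smult (of_nat (Suc k)) (monic_hermite (Suc k))"
      unfolding expand smult_diff_right smult_smult mult_smult_right by (simp only: mult.commute add_diff_eq)
    finally show ?thesis
      unfolding Suc of_nat_Suc[of "Suc k"] smult_add_left by (simp del: of_nat_Suc monic_hermite.simps)
  qed
qed

lemma hermite_0: "hermite 0 = 1"
  by (simp add: hermite_def)

lemma pderiv_hermite: "pderiv (hermite n) = (if n = 0 then 0 else hermite (n - 1))"
proof (cases n)
  case (Suc k)
  have "real (Suc k) / fact (Suc k) = 1 / fact k" by (simp add: divide_simps)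
  then show ?thesis
    by (simp add: Suc hermite_def pderiv_smult pderiv_monic_hermite del: monic_hermite.simps(2,3) fact_Suc of_nat_Suc)
qed (simp add: hermite_def)

text \<open>Once derivatives are index shifts, Hermite's differential equation is the three-term
  recurrence multiplied by \<open>n\<close>.\<close>

lemma hermite_ode:
  "Polynomial.smult (of_nat n) (hermite n) = [:0, 1:] * pderiv (hermite n) - pderiv (pderiv (hermite n))"
proof -
  have "Polynomial.smult (of_nat n) (monic_hermite n)
      = [:0, 1:] * pderiv (monic_hermite n) - pderiv (pderiv (monic_hermite n))"
  proof (cases n)
    case (Suc k)
    then show ?thesis
      by (cases k) (simp_all add: pderiv_monic_hermite pderiv_smult of_nat_poly smult_diff_right
          del: monic_hermite.simps(3), simp_all add: of_nat_poly smult_diff_right pderiv_pCons one_pCons)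
  qed simp
  from arg_cong[OF this, of "Polynomial.smult (1 / fact n)"] show ?thesis
    by (simp add: hermite_def pderiv_smult smult_diff_right mult.commute)
qed

section \<open>Lowering indices in products of Hermite polynomials\<close>

text \<open>
  The pairs \<open>(ms, t)\<close> index the terms \<open>x\<^sup>t \<Prod>\<^sub>j e(ms\<^sub>j)\<close> obtained by multiplying out
  \<open>\<Prod>\<^sub>j (e(n\<^sub>j) + x e(n\<^sub>j - 1))\<close>, where \<open>e(-1) = 0\<close>.
\<close>

fun lowerings :: "nat list \<Rightarrow> (nat list \<times> nat) list" where
  "lowerings [] = [([], 0)]"
| "lowerings (n # ns) = map (\<lambda>(ms, t). (n # ms, t)) (lowerings ns) @
     (if n = 0 then [] else map (\<lambda>(ms, t). ((n - 1) # ms, Suc t)) (lowerings ns))"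

text \<open>This makes the index sum drop in the induction for the limit, and fixes the power of
  \<open>N\<close> that each term carries.\<close>

lemma sum_list_lowerings: "(ms, t) \<in> set (lowerings ns) \<Longrightarrow> sum_list ms + t = sum_list ns"
  by (induction ns arbitrary: ms t) (auto split: if_splits)

text \<open>Exactly one choice lowers nothing, and it leaves \<open>ns\<close> intact.\<close>

lemma sum_lowerings_unchanged:
  fixes f :: "nat list \<Rightarrow> 'b::comm_monoid_add"
  shows "(\<Sum>(ms, t)\<leftarrow>lowerings ns. if t = 0 then f ms else 0) = f ns"
proof (induction ns arbitrary: f)
  case (Cons n ns)
  show ?case using Cons.IH[of "\<lambda>ms. f (n # ms)"]
    by (simp add: case_prod_unfold comp_def cong: if_cong)
qed simp

definition hermite_prod :: "nat list \<Rightarrow> real poly" where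
  "hermite_prod ns = (\<Prod>n\<leftarrow>ns. hermite n)"

text \<open>
  As \<open>h\<^sub>n' = h\<^sub>n\<^sub>-\<^sub>1\<close> for \<open>h\<^sub>n = hermite n\<close>, this is the sum of all products obtained from \<open>hermite_prod ns\<close>
  by differentiating \<open>t\<close> of the factors.
\<close>

definition lowered_prod :: "nat \<Rightarrow> nat list \<Rightarrow> real poly" where
  "lowered_prod t ns = (\<Sum>(ms, u)\<leftarrow>lowerings ns. if u = t then hermite_prod ms else 0)"

lemma hermite_prod_simps [simp]:
  "hermite_prod [] = 1" "hermite_prod (n # ns) = hermite n * hermite_prod ns"
  by (simp_all add: hermite_prod_def)

lemma sum_list_pair_if_mult:
  fixes c :: "'b::semiring_0"
  shows "(\<Sum>(x, u)\<leftarrow>xs. if u = t then c * f x else 0) = c * (\<Sum>(x, u)\<leftarrow>xs. if u = t then f x else 0)"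
  by (induction xs) (auto simp: distrib_left)

lemma lowered_prod_0: "lowered_prod 0 ns = hermite_prod ns"
  unfolding lowered_prod_def by (rule sum_lowerings_unchanged)

lemma lowered_prod_Nil: "lowered_prod (Suc t) [] = 0"
  by (simp add: lowered_prod_def)

text \<open>The head is either kept or lowered. For \<open>n = 0\<close> it cannot be lowered, in
  agreement with \<open>pderiv (hermite 0) = 0\<close>.\<close>

lemma lowered_prod_Cons:
  "lowered_prod (Suc t) (n # ns)
     = hermite n * lowered_prod (Suc t) ns + pderiv (hermite n) * lowered_prod t ns"
proof -
  have "(\<Sum>(ms, u)\<leftarrow>lowerings ns. if u = Suc t then hermite n * hermite_prod ms else 0)
      = hermite n * lowered_prod (Suc t) ns"
    unfolding lowered_prod_def by (rule sum_list_pair_if_mult)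
  moreover have "(\<Sum>(ms, u)\<leftarrow>lowerings ns. if u = t then hermite (n - 1) * hermite_prod ms else 0)
      = hermite (n - 1) * lowered_prod t ns"
    unfolding lowered_prod_def by (rule sum_list_pair_if_mult)
  ultimately show ?thesis
    by (simp add: lowered_prod_def pderiv_hermite case_prod_unfold comp_def cong: if_cong)
qed

text \<open>This is the Leibniz rule.\<close>

lemma lowered_prod_1: "lowered_prod 1 ns = pderiv (hermite_prod ns)"
  by (induction ns)
    (simp_all add: lowered_prod_Nil lowered_prod_Cons lowered_prod_0 pderiv_mult pderiv_1 algebra_simps)

text \<open>The equations of the single factors add up, except that the second derivative of
  \<open>h * P\<close> contains the cross term \<open>2 * pderiv h * pderiv P\<close>. The pairs
  that include the new factor \<open>h\<close> compensate for it.\<close>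

lemma hermite_prod_ode:
  "of_nat (sum_list ns) * hermite_prod ns
     = [:0, 1:] * pderiv (hermite_prod ns) - pderiv (pderiv (hermite_prod ns)) + 2 * lowered_prod 2 ns"
proof (induction ns)
  case Nil
  then show ?case by (simp add: lowered_prod_Nil numeral_2_eq_2)
next
  case (Cons n ns)
  define P h x where "P = hermite_prod ns" and "h = hermite n" and "x = [:0, 1::real:]"
  have ode: "of_nat n * h = x * pderiv h - pderiv (pderiv h)"
    using hermite_ode[of n] by (simp add: h_def x_def of_nat_poly)
  have low: "lowered_prod 2 (n # ns) = h * lowered_prod 2 ns + pderiv h * pderiv P"
    by (simp add: numeral_2_eq_2 lowered_prod_Cons lowered_prod_1[simplified] h_def P_def)
  have "of_nat (sum_list (n # ns)) * hermite_prod (n # ns)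
      = (of_nat n * h) * P + h * (of_nat (sum_list ns) * P)"
    by (simp add: h_def P_def algebra_simps)
  also have "\<dots> = (x * pderiv h - pderiv (pderiv h)) * P
      + h * (x * pderiv P - pderiv (pderiv P) + 2 * lowered_prod 2 ns)"
    unfolding ode using Cons.IH by (simp add: P_def x_def)
  also have "\<dots> = x * pderiv (h * P) - pderiv (pderiv (h * P)) + 2 * lowered_prod 2 (n # ns)"
    unfolding low pderiv_mult pderiv_add by (simp add: algebra_simps)
  finally show ?case by (simp add: h_def P_def x_def)
qed

text \<open>Integration by parts cancels the first two terms of \<open>hermite_prod_ode\<close>,
  which leaves the recursion required of the limits.\<close>

lemma gauss_poly_lowered_prod:
  "gauss_poly (lowered_prod 2 ns) = of_nat (sum_list ns) / 2 * gauss_poly (hermite_prod ns)"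
proof -
  have two: "2 * lowered_prod 2 ns = Polynomial.smult 2 (lowered_prod 2 ns)"
    by (simp add: numeral_poly)
  have "Polynomial.smult (of_nat (sum_list ns)) (hermite_prod ns)
     = [:0, 1:] * pderiv (hermite_prod ns) - pderiv (pderiv (hermite_prod ns))
       + Polynomial.smult 2 (lowered_prod 2 ns)"
    using hermite_prod_ode[of ns] unfolding two by (simp add: of_nat_poly)
  from arg_cong[OF this, of gauss_poly] show ?thesis
    unfolding gauss_poly_simps gauss_poly_x_mult by simp
qed

lemma gauss_poly_lowered_prod_sum_list:
  "gauss_poly (lowered_prod t ns)
     = (\<Sum>(ms, u)\<leftarrow>lowerings ns. if u = t then gauss_poly (hermite_prod ms) else 0)"
proof -
  have "gauss_poly (\<Sum>(ms, u)\<leftarrow>xs. if u = t then hermite_prod ms else 0)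
     = (\<Sum>(ms, u)\<leftarrow>xs. if u = t then gauss_poly (hermite_prod ms) else 0)" for xs
    by (induction xs) (auto simp: gauss_poly_simps)
  then show ?thesis by (simp add: lowered_prod_def)
qed

section \<open>Mixed moments of elementary symmetric polynomials\<close>

text \<open>
  This is the product state of \<open>e(n\<^sub>1) \<dots> e(n\<^sub>m) (b\<^bsup>c(1)\<^esup> \<otimes> \<dots> \<otimes> b\<^bsup>c(N)\<^esup>)\<close>, where \<open>e(n)\<close> is the
  \<open>n\<close>-th elementary symmetric polynomial in \<open>b(1), \<dots>, b(N)\<close> and \<open>\<mu> k = \<phi> (b\<^sup>k)\<close>.
\<close>

fun elementary_moment :: "(nat \<Rightarrow> complex) \<Rightarrow> nat \<Rightarrow> nat list \<Rightarrow> (nat \<Rightarrow> nat) \<Rightarrow> complex" where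
  "elementary_moment \<mu> N [] c = (\<Prod>i\<in>{1..N}. \<mu> (c i))"
| "elementary_moment \<mu> N (n # ns) c =
     (\<Sum>S | S \<subseteq> {1..N} \<and> card S = n. elementary_moment \<mu> N ns (\<lambda>i. c i + of_bool (i \<in> S)))"

lemma elementary_moment_cong:
  "(\<And>i. i \<in> {1..N} \<Longrightarrow> c i = d i) \<Longrightarrow> elementary_moment \<mu> N ns c = elementary_moment \<mu> N ns d"
proof (induction ns arbitrary: c d)
  case (Cons n ns)
  show ?case unfolding elementary_moment.simps
    by (intro sum.cong refl Cons.IH) (simp add: Cons.prems)
qed (auto intro!: prod.cong)

lemma sum_subsets_Suc:
  fixes f :: "nat set \<Rightarrow> 'b::comm_monoid_add"
  shows "(\<Sum>S | S \<subseteq> {1..Suc N} \<and> card S = n. f S) = (\<Sum>S | S \<subseteq> {1..N} \<and> card S = n. f S)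
    + (if n = 0 then 0 else \<Sum>S | S \<subseteq> {1..N} \<and> card S = n - 1. f (insert (Suc N) S))"
proof -
  let ?A = "\<lambda>n. {S. S \<subseteq> {1..N} \<and> card S = n}"
  let ?B = "{S. S \<subseteq> {1..Suc N} \<and> card S = n \<and> Suc N \<in> S}"
  have fin: "finite S" if "S \<subseteq> {1..Suc N}" for S
    using that finite_subset by blast
  have "{S. S \<subseteq> {1..Suc N} \<and> card S = n} = ?A n \<union> ?B"
    by (auto simp: subset_iff le_Suc_eq)
  moreover have "?A n \<inter> ?B = {}" by auto
  moreover have "finite (?A n)" "finite ?B"
    by (auto intro: finite_subset[of _ "Pow {1..Suc N}"])
  ultimately have "(\<Sum>S | S \<subseteq> {1..Suc N} \<and> card S = n. f S) = sum f (?A n) + sum f ?B"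
    by (simp add: sum.union_disjoint)
  moreover have "sum f ?B = (if n = 0 then 0 else \<Sum>S\<in>?A (n - 1). f (insert (Suc N) S))"
  proof (cases "n = 0")
    case True
    then have "?B = {}" using fin by auto
    then have "sum f ?B = 0" by (simp only: sum.empty)
    with True show ?thesis by simp
  next
    case False
    have "bij_betw (insert (Suc N)) (?A (n - 1)) ?B"
    proof (rule bij_betw_byWitness[where f' = "\<lambda>S. S - {Suc N}"])
      show "insert (Suc N) ` ?A (n - 1) \<subseteq> ?B"
      proof safe
        fix S assume S: "S \<subseteq> {1..N}" "card S = n - 1"
        then have "Suc N \<notin> S" "finite S" by (auto intro: finite_subset)
        then show "card (insert (Suc N) S) = n" using S False by simp
      qed auto
      show "(\<lambda>S. S - {Suc N}) ` ?B \<subseteq> ?A (n - 1)"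
        using fin by (auto simp: subset_iff le_Suc_eq)
    qed auto
    then show ?thesis using False by (simp add: sum.reindex_bij_betw[symmetric])
  qed
  ultimately show ?thesis by simp
qed

lemma sum_sum_list_swap:
  "(\<Sum>x\<in>X. \<Sum>(y, t)\<leftarrow>ys. f x y t) = (\<Sum>(y, t)\<leftarrow>ys. \<Sum>x\<in>X. f x y t)"
  by (induction ys) (auto simp: sum.distrib)

text \<open>Each factor either avoids the position \<open>Suc N\<close> or uses it and has one index
  fewer to place. If \<open>t\<close> factors use it, that position contributes
  \<open>\<mu> (c (Suc N) + t)\<close>.\<close>

lemma elementary_moment_Suc:
  "elementary_moment \<mu> (Suc N) ns c
     = (\<Sum>(ms, t)\<leftarrow>lowerings ns. \<mu> (c (Suc N) + t) * elementary_moment \<mu> N ms c)"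
proof (induction ns arbitrary: c)
  case Nil
  then show ?case by simp
next
  case (Cons n ns)
  let ?A = "\<lambda>n. {S. S \<subseteq> {1..N} \<and> card S = n}"
  have out: "(\<Sum>S\<in>?A k. elementary_moment \<mu> (Suc N) ns (\<lambda>i. c i + of_bool (i \<in> S)))
     = (\<Sum>(ms, t)\<leftarrow>lowerings ns. \<mu> (c (Suc N) + t) * elementary_moment \<mu> N (k # ms) c)" for k
  proof -
    have "(\<Sum>S\<in>?A k. elementary_moment \<mu> (Suc N) ns (\<lambda>i. c i + of_bool (i \<in> S)))
       = (\<Sum>S\<in>?A k. \<Sum>(ms, t)\<leftarrow>lowerings ns. \<mu> (c (Suc N) + t)
           * elementary_moment \<mu> N ms (\<lambda>i. c i + of_bool (i \<in> S)))"
    proof (rule sum.cong)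
      fix S assume "S \<in> ?A k"
      then have "Suc N \<notin> S" by auto
      then show "elementary_moment \<mu> (Suc N) ns (\<lambda>i. c i + of_bool (i \<in> S))
        = (\<Sum>(ms, t)\<leftarrow>lowerings ns. \<mu> (c (Suc N) + t)
           * elementary_moment \<mu> N ms (\<lambda>i. c i + of_bool (i \<in> S)))"
        by (simp add: Cons.IH)
    qed simp
    then show ?thesis by (simp add: sum_sum_list_swap sum_distrib_left)
  qed
  have "in": "(\<Sum>S\<in>?A k. elementary_moment \<mu> (Suc N) ns (\<lambda>i. c i + of_bool (i \<in> insert (Suc N) S)))
     = (\<Sum>(ms, t)\<leftarrow>lowerings ns. \<mu> (c (Suc N) + Suc t) * elementary_moment \<mu> N (k # ms) c)" for k
  proof -
    have "(\<Sum>S\<in>?A k. elementary_moment \<mu> (Suc N) ns (\<lambda>i. c i + of_bool (i \<in> insert (Suc N) S)))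
       = (\<Sum>S\<in>?A k. \<Sum>(ms, t)\<leftarrow>lowerings ns. \<mu> (c (Suc N) + Suc t)
           * elementary_moment \<mu> N ms (\<lambda>i. c i + of_bool (i \<in> S)))"
    proof (rule sum.cong)
      fix S assume "S \<in> ?A k"
      \<comment> \<open>The new occurrence of \<open>Suc N\<close> is already counted in
        \<open>Suc t\<close>; the positions up to \<open>N\<close> do not see it.\<close>
      have "elementary_moment \<mu> N ms (\<lambda>i. c i + of_bool (i \<in> insert (Suc N) S))
        = elementary_moment \<mu> N ms (\<lambda>i. c i + of_bool (i \<in> S))" for ms
        by (rule elementary_moment_cong) simp
      then show "elementary_moment \<mu> (Suc N) ns (\<lambda>i. c i + of_bool (i \<in> insert (Suc N) S))
        = (\<Sum>(ms, t)\<leftarrow>lowerings ns. \<mu> (c (Suc N) + Suc t)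
           * elementary_moment \<mu> N ms (\<lambda>i. c i + of_bool (i \<in> S)))"
        unfolding Cons.IH by simp
    qed simp
    then show ?thesis by (simp add: sum_sum_list_swap sum_distrib_left)
  qed
  show ?case
    unfolding elementary_moment.simps(2) sum_subsets_Suc out "in"
    by (simp add: case_prod_unfold comp_def)
qed

lemma elementary_moment_zeros:
  assumes "\<mu> 0 = 1" and "sum_list ns = 0"
  shows "elementary_moment \<mu> N ns (\<lambda>_. 0) = 1"
  using assms(2)
proof (induction ns)
  case (Cons n ns)
  have "{S. S \<subseteq> {1..N} \<and> card S = 0} = {{}}"
    by (auto dest: finite_subset)
  with Cons show ?case by simp
qed (simp add: assms)

section \<open>Limits of the normalised moments\<close>

lemma tendsto_sum_list:
  fixes f :: "nat \<Rightarrow> 'b \<Rightarrow> 'c::topological_comm_monoid_add"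
  assumes "\<And>x. x \<in> set xs \<Longrightarrow> (\<lambda>n. f n x) \<longlonglongrightarrow> l x"
  shows "(\<lambda>n. \<Sum>x\<leftarrow>xs. f n x) \<longlonglongrightarrow> (\<Sum>x\<leftarrow>xs. l x)"
  using assms by (induction xs) (auto intro!: tendsto_add)

theorem elementary_moment_tendsto:
  assumes "\<mu> 0 = 1" "\<mu> 1 = 0" "\<mu> 2 = 1"
  shows "(\<lambda>N. elementary_moment \<mu> N ns (\<lambda>_. 0) / of_real (real N powr (real (sum_list ns) / 2)))
    \<longlonglongrightarrow> of_real (gauss_poly (hermite_prod ns))"
proof (induction "sum_list ns" arbitrary: ns rule: less_induct)
  case less
  define F where "F ms N = elementary_moment \<mu> N ms (\<lambda>_. 0)" for ms N
  show ?case
  proof (cases "sum_list ns = 0")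
    case True
    then have "hermite_prod ns = 1"
      by (induction ns) (auto simp: hermite_0)
    then have gauss: "gauss_poly (hermite_prod ns) = 1" by (simp add: gauss_poly_one)
    \<comment> \<open>The position \<open>N = 0\<close> is excluded because
      \<open>0 powr 0 = 0\<close>.\<close>
    have "\<forall>\<^sub>F N in sequentially.
        1 = elementary_moment \<mu> N ns (\<lambda>_. 0) / of_real (real N powr (real (sum_list ns) / 2))"
      using eventually_gt_at_top[of 0]
      by eventually_elim (simp add: elementary_moment_zeros[of \<mu>, OF assms(1) True] True del: sum_list_eq_0_iff)
    from Lim_transform_eventually[OF tendsto_const this] show ?thesis
      by (simp only: gauss of_real_1)
  next
    case False
    define s where "s = real (sum_list ns) / 2"
    have s: "s > 0" using False by (simp add: s_def del: sum_list_eq_0_iff)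
    \<comment> \<open>The unique term with \<open>t = 0\<close> is \<open>F ns N\<close> itself, as
      \<open>\<mu> 0 = 1\<close>.\<close>
    have diff: "F ns (Suc N) - F ns N = (\<Sum>(ms, t)\<leftarrow>lowerings ns. if t = 0 then 0 else \<mu> t * F ms N)" for N
    proof -
      have "F ns (Suc N) = (\<Sum>(ms, t)\<leftarrow>lowerings ns. \<mu> t * F ms N)"
        by (simp add: F_def elementary_moment_Suc)
      also have "\<dots> = (\<Sum>(ms, t)\<leftarrow>lowerings ns. if t = 0 then F ms N else 0)
          + (\<Sum>(ms, t)\<leftarrow>lowerings ns. if t = 0 then 0 else \<mu> t * F ms N)"
        unfolding sum_list_addf[symmetric]
        by (intro arg_cong[of _ _ sum_list] map_cong) (auto simp: assms)
      finally show ?thesis by (simp add: sum_lowerings_unchanged)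
    qed
    have term_lim: "(\<lambda>N. (case x of (ms, t) \<Rightarrow> if t = 0 then 0 else \<mu> t * F ms N) / of_real (real N powr (s - 1)))
      \<longlonglongrightarrow> of_real (case x of (ms, t) \<Rightarrow> if t = 2 then gauss_poly (hermite_prod ms) else 0)"
      if "x \<in> set (lowerings ns)" for x
    proof -
      obtain ms t where x: "x = (ms, t)" by (cases x)
      have sum: "sum_list ms + t = sum_list ns" using that x sum_list_lowerings by simp
      consider "t = 0" | "t = 1" | "t \<ge> 2" by linarith
      then show ?thesis
      proof cases
        case 3
        define r where "r = real (sum_list ms) / 2"
        have r: "r = s - real t / 2" using sum by (simp add: r_def s_def field_simps flip: of_nat_add)
        have "(\<lambda>N. F ms N / of_real (real N powr r)) \<longlonglongrightarrow> of_real (gauss_poly (hermite_prod ms))"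
          unfolding F_def r_def using 3 sum by (intro less) auto
        \<comment> \<open>The exponent \<open>1 - t / 2\<close> equals \<open>r - (s - 1)\<close>:
          the natural order of \<open>F ms\<close> compared with that of the increment. Only
          \<open>t = 2\<close> balances the two.\<close>
        moreover have "(\<lambda>N. real N powr (1 - real t / 2)) \<longlonglongrightarrow> (if t = 2 then 1 else 0)"
        proof (cases "t = 2")
          case True
          have "\<forall>\<^sub>F N in sequentially. 1 = real N powr (1 - real t / 2)"
            using eventually_gt_at_top[of 0] by eventually_elim (simp add: True)
          then show ?thesis using True by (simp add: Lim_transform_eventually[OF tendsto_const])
        next
          case False
          then have "1 - real t / 2 < 0" using 3 by simp
          then have "(\<lambda>N. real N powr (1 - real t / 2)) \<longlonglongrightarrow> 0" by real_asymp
          then show ?thesis using False by simp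
        qed
        ultimately have "(\<lambda>N. \<mu> t * (F ms N / of_real (real N powr r) * of_real (real N powr (1 - real t / 2))))
          \<longlonglongrightarrow> \<mu> t * (of_real (gauss_poly (hermite_prod ms)) * of_real (if t = 2 then 1 else 0))"
          by (intro tendsto_intros)
        moreover have "\<forall>\<^sub>F N in sequentially.
            \<mu> t * (F ms N / of_real (real N powr r) * of_real (real N powr (1 - real t / 2)))
            = \<mu> t * F ms N / of_real (real N powr (s - 1))"
          using eventually_gt_at_top[of 0]
        proof eventually_elim
          case (elim N)
          have "real N powr r = real N powr (s - 1) * real N powr (1 - real t / 2)"
            by (simp add: r flip: powr_add)
          then show ?case using elim by simp
        qed
        ultimately have "(\<lambda>N. \<mu> t * F ms N / of_real (real N powr (s - 1)))
          \<longlonglongrightarrow> \<mu> t * (of_real (gauss_poly (hermite_prod ms)) * of_real (if t = 2 then 1 else 0))"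
          by (rule Lim_transform_eventually)
        then show ?thesis using 3 x assms by (cases "t = 2") auto
      qed (use x assms in auto)
    qed
    have "(\<lambda>N. \<Sum>x\<leftarrow>lowerings ns. (case x of (ms, t) \<Rightarrow> if t = 0 then 0 else \<mu> t * F ms N) / of_real (real N powr (s - 1)))
      \<longlonglongrightarrow> (\<Sum>x\<leftarrow>lowerings ns. of_real (case x of (ms, t) \<Rightarrow> if t = 2 then gauss_poly (hermite_prod ms) else 0))"
      by (intro tendsto_sum_list term_lim)
    moreover have "(\<Sum>x\<leftarrow>xs. f x / c) = (\<Sum>x\<leftarrow>xs. f x) / c" for f and c :: complex and xs :: "(nat list \<times> nat) list"
      by (induction xs) (simp_all add: add_divide_distrib)
    moreover have "(\<Sum>x\<leftarrow>xs. of_real (f x)) = (of_real (\<Sum>x\<leftarrow>xs. f x) :: complex)" for f and xs :: "(nat list \<times> nat) list"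
      by (induction xs) simp_all
    ultimately have "(\<lambda>N. (F ns (Suc N) - F ns N) / of_real (real N powr (s - 1)))
      \<longlonglongrightarrow> of_real (gauss_poly (lowered_prod 2 ns))"
      unfolding diff gauss_poly_lowered_prod_sum_list by simp
    \<comment> \<open>Division by \<open>s\<close> cancels the factor \<open>sum_list ns / 2\<close>
      from \<open>gauss_poly_lowered_prod\<close>.\<close>
    from tendsto_powr_of_differences[OF s this]
    show ?thesis using False
      by (simp add: gauss_poly_lowered_prod F_def s_def del: sum_list_eq_0_iff)
  qed
qed

section \<open>Reduction of the tensor power to scalar moments\<close>

context unital_star_algebra
begin

lemma nat_pow_scale:
  assumes "a \<in> carrier A"
  shows "(c \<odot> a) [^] (m :: nat) = (c ^ m) \<odot> (a [^] m)"
  using assms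
  by (induction m) (simp_all add: scale_one mult_scale_left mult_scale_right scale_scale mult.commute)

text \<open>Distinct positions put at most one \<open>b\<close> into each slot. Writing the slots as
  powers of \<open>b\<close> lets later products simply add exponents.\<close>

lemma foldr_at_position:
  assumes "b \<in> carrier A" and "distinct is"
  shows "foldr (\<lambda>i t. at_position A N b i \<otimes>\<^bsub>tensor_power A N\<^esub> t) is \<one>\<^bsub>tensor_power A N\<^esub>
    = pure_tensor A N (\<lambda>j. b [^] (of_bool (j \<in> set is) :: nat))"
  using assms(2)
proof (induction "is")
  case Nil
  then show ?case by (simp add: tensor_power_def)
next
  case (Cons i "is")
  have "at_position A N b i \<otimes>\<^bsub>tensor_power A N\<^esub> pure_tensor A N (\<lambda>j. b [^] (of_bool (j \<in> set is) :: nat))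
    = pure_tensor A N (\<lambda>j. (if j = i then b else \<one>) \<otimes> b [^] (of_bool (j \<in> set is) :: nat))"
    unfolding at_position_def using assms(1) by (subst pure_tensor_mult) auto
  also have "(\<lambda>j. (if j = i then b else \<one>) \<otimes> b [^] (of_bool (j \<in> set is) :: nat))
    = (\<lambda>j. b [^] (of_bool (j \<in> set (i # is)) :: nat))"
    using Cons.prems assms(1) by (auto simp: fun_eq_iff)
  finally show ?case using Cons by simp
qed

end

lemma finite_increasing_indices: "finite (increasing_indices N n)"
  by (rule finite_subset[of _ "{is. set is \<subseteq> {1..N} \<and> length is = n}"])
    (auto simp: increasing_indices_def finite_lists_length_eq)

lemma bij_betw_increasing_indices:
  "bij_betw set (increasing_indices N n) {S. S \<subseteq> {1..N} \<and> card S = n}"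
proof (rule bij_betw_byWitness[where f' = sorted_list_of_set])
  have fin: "finite S" if "S \<subseteq> {1..N}" for S
    using that finite_subset by blast
  show "\<forall>is\<in>increasing_indices N n. sorted_list_of_set (set is) = is"
    by (auto simp: increasing_indices_def strict_sorted_iff sorted_distinct_set_unique)
  show "\<forall>S\<in>{S. S \<subseteq> {1..N} \<and> card S = n}. set (sorted_list_of_set S) = S"
    using fin by simp
  show "set ` increasing_indices N n \<subseteq> {S. S \<subseteq> {1..N} \<and> card S = n}"
    by (auto simp: increasing_indices_def strict_sorted_iff distinct_card)
  show "sorted_list_of_set ` {S. S \<subseteq> {1..N} \<and> card S = n} \<subseteq> increasing_indices N n"
  proof (rule image_subsetI)
    fix S assume "S \<in> {S. S \<subseteq> {1..N} \<and> card S = n}"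
    with fin[of S] show "sorted_list_of_set S \<in> increasing_indices N n"
      by (simp add: increasing_indices_def strict_sorted_iff)
  qed
qed

context algebraic_probability_space
begin

lemma product_state_finsum:
  assumes "finite I" and "f \<in> I \<rightarrow> carrier (tensor_power A N)"
  shows "product_state \<phi> N (\<Oplus>\<^bsub>tensor_power A N\<^esub>i\<in>I. f i) = (\<Sum>i\<in>I. product_state \<phi> N (f i))"
proof -
  interpret T: unital_star_algebra "tensor_power A N" by (rule tensor_power_unital_star_algebra)
  have "product_state \<phi> N \<zero>\<^bsub>tensor_power A N\<^esub> = 0"
    using product_state_add[OF T.zero_closed T.zero_closed] by simp
  with assms show ?thesis
    by (induction I rule: finite_induct) (simp_all add: product_state_add T.finsum_closed)
qed

lemma elementary_sum_eq:
  assumes "b \<in> carrier A"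
  shows "elementary_sum A b N n = (\<Oplus>\<^bsub>tensor_power A N\<^esub>is\<in>increasing_indices N n.
    pure_tensor A N (\<lambda>j. b [^] (of_bool (j \<in> set is) :: nat)))"
proof -
  interpret T: unital_star_algebra "tensor_power A N" by (rule tensor_power_unital_star_algebra)
  show ?thesis unfolding elementary_sum_def
    by (intro T.finsum_cong refl)
      (use assms in \<open>auto simp: simp_implies_def increasing_indices_def strict_sorted_iff foldr_at_position
        intro!: pure_tensor_closed\<close>)
qed

lemma elementary_sum_closed:
  assumes "b \<in> carrier A"
  shows "elementary_sum A b N n \<in> carrier (tensor_power A N)"
proof -
  interpret T: unital_star_algebra "tensor_power A N" by (rule tensor_power_unital_star_algebra)
  show ?thesis unfolding elementary_sum_eq[OF assms]
    by (intro T.finsum_closed) (use assms in \<open>auto intro!: pure_tensor_closed\<close>)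
qed

text \<open>The trailing pure tensor is an accumulator: the rightmost factor of the power is
  expanded and absorbed into the exponents \<open>c\<close>. Noncommutativity causes no trouble, as
  every slot holds a power of the same \<open>b\<close>.\<close>

lemma product_state_elementary_sum_pow:
  assumes b: "b \<in> carrier A"
  shows "product_state \<phi> N (elementary_sum A b N n [^]\<^bsub>tensor_power A N\<^esub> m
      \<otimes>\<^bsub>tensor_power A N\<^esub> pure_tensor A N (\<lambda>i. b [^] c i))
    = elementary_moment (\<lambda>k. \<phi> (b [^] k)) N (replicate m n) c"
proof (induction m arbitrary: c)
  case 0
  interpret T: unital_star_algebra "tensor_power A N" by (rule tensor_power_unital_star_algebra)
  show ?case using b by (simp add: product_state_pure_tensor pure_tensor_closed)
next
  case (Suc m)
  interpret T: unital_star_algebra "tensor_power A N" by (rule tensor_power_unital_star_algebra)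
  let ?T = "tensor_power A N" and ?E = "elementary_sum A b N n" and ?I = "increasing_indices N n"
  let ?p = "\<lambda>c :: nat \<Rightarrow> nat. pure_tensor A N (\<lambda>i. b [^] c i)"
  have p: "?p c \<in> carrier ?T" for c using b by (intro pure_tensor_closed) simp
  have E: "?E \<in> carrier ?T" using b by (rule elementary_sum_closed)
  have "?E \<otimes>\<^bsub>?T\<^esub> ?p c = (\<Oplus>\<^bsub>?T\<^esub>is\<in>?I. ?p (\<lambda>i. of_bool (i \<in> set is)) \<otimes>\<^bsub>?T\<^esub> ?p c)"
    unfolding elementary_sum_eq[OF b]
    by (rule T.finsum_ldistr) (use p finite_increasing_indices in auto)
  also have "\<dots> = (\<Oplus>\<^bsub>?T\<^esub>is\<in>?I. ?p (\<lambda>i. c i + of_bool (i \<in> set is)))"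
    using b by (simp add: pure_tensor_mult nat_pow_mult add.commute)
  finally have "?E [^]\<^bsub>?T\<^esub> Suc m \<otimes>\<^bsub>?T\<^esub> ?p c
      = ?E [^]\<^bsub>?T\<^esub> m \<otimes>\<^bsub>?T\<^esub> (\<Oplus>\<^bsub>?T\<^esub>is\<in>?I. ?p (\<lambda>i. c i + of_bool (i \<in> set is)))"
    using E p by (simp add: T.m_assoc)
  also have "\<dots> = (\<Oplus>\<^bsub>?T\<^esub>is\<in>?I. ?E [^]\<^bsub>?T\<^esub> m \<otimes>\<^bsub>?T\<^esub> ?p (\<lambda>i. c i + of_bool (i \<in> set is)))"
    by (rule T.finsum_rdistr) (use E p finite_increasing_indices in auto)
  finally have "product_state \<phi> N (?E [^]\<^bsub>?T\<^esub> Suc m \<otimes>\<^bsub>?T\<^esub> ?p c)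
      = (\<Sum>is\<in>?I. product_state \<phi> N (?E [^]\<^bsub>?T\<^esub> m \<otimes>\<^bsub>?T\<^esub> ?p (\<lambda>i. c i + of_bool (i \<in> set is))))"
    using E p finite_increasing_indices by (simp add: product_state_finsum)
  also have "\<dots> = (\<Sum>is\<in>?I. elementary_moment (\<lambda>k. \<phi> (b [^] k)) N (replicate m n)
      (\<lambda>i. c i + of_bool (i \<in> set is)))"
    by (simp only: Suc.IH)
  also have "\<dots> = elementary_moment (\<lambda>k. \<phi> (b [^] k)) N (replicate (Suc m) n) c"
    using sum.reindex_bij_betw[OF bij_betw_increasing_indices,
      of "\<lambda>S. elementary_moment (\<lambda>k. \<phi> (b [^] k)) N (replicate m n) (\<lambda>i. c i + of_bool (i \<in> S))"]
    by simp
  finally show ?case .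
qed

lemma product_state_scaled_elementary_sum_pow:
  assumes b: "b \<in> carrier A"
  shows "product_state \<phi> N ((r \<odot>\<^bsub>tensor_power A N\<^esub> elementary_sum A b N n) [^]\<^bsub>tensor_power A N\<^esub> m)
    = r ^ m * elementary_moment (\<lambda>k. \<phi> (b [^] k)) N (replicate m n) (\<lambda>_. 0)"
proof -
  interpret T: unital_star_algebra "tensor_power A N" by (rule tensor_power_unital_star_algebra)
  have "pure_tensor A N (\<lambda>_. b [^] (0 :: nat)) = \<one>\<^bsub>tensor_power A N\<^esub>"
    by (simp add: tensor_power_def)
  with product_state_elementary_sum_pow[OF b, of N n m "\<lambda>_. 0"] elementary_sum_closed[OF b]
  show ?thesis by (simp add: T.nat_pow_scale product_state_scale)
qed

end

section \<open>Convergence in moments to the Hermite polynomial of a Gaussian\<close>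

theorem theorem3p3:
  fixes A :: "('a, 'm) star_algebra_scheme" and \<phi> :: "'a \<Rightarrow> complex" and b :: 'a
    and M :: "'w measure" and g :: "'w \<Rightarrow> real"
    and n :: nat
  assumes "algebraic_probability_space A \<phi>"
    and "b \<in> carrier A" and "star A b = b"
    and "\<phi> b = 0" and "\<phi> (b \<otimes>\<^bsub>A\<^esub> b) = 1"
    and "prob_space M" and "distributed M lborel g std_normal_density"
    and "n \<ge> 1"
  shows "\<forall>m\<ge>1::nat.
    (\<lambda>N. product_state \<phi> N
      ((complex_of_real (1 / real N powr (real n / 2))
          \<odot>\<^bsub>tensor_power A N\<^esub> elementary_sum A b N n) [^]\<^bsub>tensor_power A N\<^esub> m))
    \<longlonglongrightarrow> complex_of_real (prob_space.expectation M
        (\<lambda>\<omega>. (poly (monic_hermite n) (g \<omega>) / fact n) ^ m))"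
proof (intro allI impI)
  fix m :: nat assume "m \<ge> 1"
  interpret algebraic_probability_space A \<phi> by fact
  have b: "b \<in> carrier A" by fact
  define \<mu> where "\<mu> = (\<lambda>k :: nat. \<phi> (b [^]\<^bsub>A\<^esub> k))"
  have "\<mu> 0 = 1" "\<mu> 1 = 0" "\<mu> 2 = 1"
    using assms(4,5) b by (simp_all add: \<mu>_def state_one numeral_2_eq_2)
  note lim = elementary_moment_tendsto[OF this, of "replicate m n"]
  have "hermite_prod (replicate m n) = hermite n ^ m"
    by (induction m) simp_all
  then have "gauss_poly (hermite_prod (replicate m n)) = (\<integral>\<omega>. poly (hermite n ^ m) (g \<omega>) \<partial>M)"
    by (simp only: distributed_std_normal_poly[OF assms(7)])
  also have "\<dots> = prob_space.expectation M (\<lambda>\<omega>. (poly (monic_hermite n) (g \<omega>) / fact n) ^ m)"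
    by (simp add: hermite_def poly_power)
  finally have limit: "gauss_poly (hermite_prod (replicate m n)) = \<dots>" .
  have "product_state \<phi> N
      ((complex_of_real (1 / real N powr (real n / 2))
          \<odot>\<^bsub>tensor_power A N\<^esub> elementary_sum A b N n) [^]\<^bsub>tensor_power A N\<^esub> m)
    = elementary_moment \<mu> N (replicate m n) (\<lambda>_. 0) / of_real (real N powr (real (sum_list (replicate m n)) / 2))" for N
  proof -
    \<comment> \<open>At \<open>N = 0\<close> both sides are \<open>0\<close>, since powers of base
      \<open>0\<close> under \<open>powr\<close> vanish and \<open>m \<ge> 1\<close>.\<close>
    have "(real N powr (real n / 2)) ^ m = real N powr (real (sum_list (replicate m n)) / 2)"
      using \<open>m \<ge> 1\<close> powr_power[of "real N" "real n / 2" m]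
      by (cases "N = 0") (simp_all add: sum_list_replicate)
    then have "complex_of_real (1 / real N powr (real n / 2)) ^ m
        = 1 / of_real (real N powr (real (sum_list (replicate m n)) / 2))"
      by (metis of_real_1 of_real_divide of_real_power power_one_over)
    then show ?thesis
      unfolding product_state_scaled_elementary_sum_pow[OF b] \<mu>_def by simp
  qed
  with lim limit show "(\<lambda>N. product_state \<phi> N
      ((complex_of_real (1 / real N powr (real n / 2))
          \<odot>\<^bsub>tensor_power A N\<^esub> elementary_sum A b N n) [^]\<^bsub>tensor_power A N\<^esub> m))
    \<longlonglongrightarrow> complex_of_real (prob_space.expectation M
        (\<lambda>\<omega>. (poly (monic_hermite n) (g \<omega>) / fact n) ^ m))"
    by simp
qed

end
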